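(* Let $\{X_n\}_{n\ge1}$ be a strictly stationary sequence of centered, square integrable, associated random variables with $\sum_{j=1}^\infty c_j<\infty$, where $c_j=\mathrm{Cov}(X_1,X_{1+j})$, and $\sigma^2:=E X_1^2+2\sum_{j=1}^\infty c_j>0$. Let $S_n=\sum_{j=1}^nX_j$, $s_n^2=ES_n^2$. Assume (A1) $E|X_1|^q<\infty$ for some $q>2$, and (A2) $\left|\frac{s_n^2}{n\sigma^2}-1\right|=O(n^{-\theta})$ for some $\theta>0$. Let $x_n$ be a sequence such that (i) $\limsup_{n\to\infty}\frac{x_n^2}{\log n}=\lambda<\frac{q-2}{2}$, and (ii) $\theta>1+\lambda$. Then, with $\Phi$ the standard normal distribution function, $$P(S_n>x_ns_n)=(1-\Phi(x_n))(1+o(1))\quad (n\to\infty).$$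
   Context: Associated: $\mathrm{Cov}(f(X_1,\dots,X_k),g(X_1,\dots,X_k))\ge0$ for all coordinatewise nondecreasing $f,g$ for which it exists, for every finite initial segment. *)

theory Defs
  imports "HOL-Probability.Probability" "HOL-Library.Landau_Symbols"
begin

definition Phi :: "real \<Rightarrow> real" where
  "Phi x = measure (density lborel std_normal_density) {..x}"

definition initvec :: "(nat \<Rightarrow> 'a \<Rightarrow> real) \<Rightarrow> nat \<Rightarrow> 'a \<Rightarrow> (nat \<Rightarrow> real)" where
  "initvec X k \<omega> = (\<lambda>i\<in>{1..k}. X i \<omega>)"

definition strictly_stationary :: "'a measure \<Rightarrow> (nat \<Rightarrow> 'a \<Rightarrow> real) \<Rightarrow> bool" where
  "strictly_stationary M X \<longleftrightarrow>
     (\<forall>k h. distr M (PiM {1..k} (\<lambda>_. borel)) (\<lambda>\<omega>. \<lambda>i\<in>{1..k}. X (i + h) \<omega>)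
          = distr M (PiM {1..k} (\<lambda>_. borel)) (\<lambda>\<omega>. \<lambda>i\<in>{1..k}. X i \<omega>))"

definition coordwise_mono :: "nat \<Rightarrow> ((nat \<Rightarrow> real) \<Rightarrow> real) \<Rightarrow> bool" where
  "coordwise_mono k f \<longleftrightarrow>
     (\<forall>x\<in>PiE {1..k} (\<lambda>_. UNIV). \<forall>y\<in>PiE {1..k} (\<lambda>_. UNIV).
        (\<forall>i\<in>{1..k}. x i \<le> y i) \<longrightarrow> f x \<le> f y)"

definition associated :: "'a measure \<Rightarrow> (nat \<Rightarrow> 'a \<Rightarrow> real) \<Rightarrow> bool" where
  "associated M X \<longleftrightarrow>
     (\<forall>k f g. coordwise_mono k f \<and> coordwise_mono k g
        \<and> integrable M (\<lambda>\<omega>. f (initvec X k \<omega>))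
        \<and> integrable M (\<lambda>\<omega>. g (initvec X k \<omega>))
        \<and> integrable M (\<lambda>\<omega>. f (initvec X k \<omega>) * g (initvec X k \<omega>))
        \<longrightarrow> (\<integral>\<omega>. f (initvec X k \<omega>) * g (initvec X k \<omega>) \<partial>M)
             - (\<integral>\<omega>. f (initvec X k \<omega>) \<partial>M) * (\<integral>\<omega>. g (initvec X k \<omega>) \<partial>M) \<ge> 0)"

definition covar :: "'a measure \<Rightarrow> ('a \<Rightarrow> real) \<Rightarrow> ('a \<Rightarrow> real) \<Rightarrow> real" where
  "covar M U V = (\<integral>\<omega>. (U \<omega> - (\<integral>\<eta>. U \<eta> \<partial>M)) * (V \<omega> - (\<integral>\<eta>. V \<eta> \<partial>M)) \<partial>M)"

end

theory Submission
  imports Defs "HOL-Real_Asymp.Real_Asymp"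
begin

text \<open>
  Condition (ii) forces independence. By stationarity and nonnegativity of the covariances,
  n \<sigma>^2 - s_n^2 is at least twice the sum of the c_j for every n, while (A2) bounds it by a
  multiple of n^(1-\<theta>), which tends to 0 because \<theta> > 1. So all c_j vanish, and uncorrelated
  associated variables are independent (Newman).

  For independent summands the claim is Lindeberg's replacement argument with an exponential weight.
  The summands are truncated at n^(1/2-\<epsilon>), and the indicator of (x,\<infinity>) is replaced by a smooth step f on an
  interval of length 1/log n. Since f and its derivatives vanish to the left of x, they are
  bounded by a multiple of exp (h (w - x)) with h = max x 0, and exchanging a summand
  for a normal one costs the corresponding multiple of exp (h w). The exponential moments of
  the truncated sums are exp (h^2/2) up to a bounded factor, so the total error is exp (-h^2/2)
  times a negative power of n, up to powers of log n. This is negligible against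
  1 - \<Phi>(x), which is at least of order exp (-h^2/2) / (1 + h).
\<close>


subsection \<open>A localized smooth step\<close>

text \<open>A uniform error bound of Berry-Esseen type cannot suffice: for x^2 near lambda log n the
  tail 1 - Phi(x) may itself be a negative power of n, so the error has to shrink with it. The
  weight exp (h w) is chosen because it is an eigenfunction of convolution: smearing by a law only
  multiplies it by the exponential moment of that law. The sum is started at w = 0, so a step
  located near x enters with the factor exp (-h x) = exp (-h^2), which the accumulated moments exp
  (h^2/2) turn into exp (-h^2/2). Taking h = max x 0 also covers negative x, where the weight is
  trivial and the tail is bounded below. The width d of the step is a compromise. Smoothing costs d
  exp (-h^2/2), so d (1 + h) has to vanish, with h of order up to sqrt (log n); the third derivative
  costs d^-3, which must stay below every power of n. The choice 1 / log n meets both. Truncation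
  spoils the mean and the variance of the summands. They are not corrected; the discrepancies are
  carried along as part of the error of a single exchange.\<close>

lemma DERIV_pos_part_power:
  fixes a t :: real
  shows "((\<lambda>t. max 0 (t - a) ^ Suc (Suc k)) has_real_derivative real (Suc (Suc k)) * max 0 (t - a) ^ Suc k) (at t)"
proof -
  consider "t < a" | "t = a" | "t > a" by linarith
  then show ?thesis
  proof cases
    case 1
    have "((\<lambda>t. 0::real) has_real_derivative 0) (at t)" by simp
    then have "((\<lambda>t. max 0 (t - a) ^ Suc (Suc k)) has_real_derivative 0) (at t)"
      by (rule DERIV_cong_ev[THEN iffD1, rotated -1])
         (use 1 in \<open>auto intro!: eventually_mono[OF order_tendstoD(2)[OF tendsto_ident_at 1]]
            simp: eventually_nhds_conv_at\<close>)
    then show ?thesis using 1 by simp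
  next
    case 3
    have "((\<lambda>t. (t - a) ^ Suc (Suc k)) has_real_derivative real (Suc (Suc k)) * (t - a) ^ Suc k) (at t)"
      using DERIV_power[of "\<lambda>t. t - a" 1 t UNIV "Suc (Suc k)"] DERIV_diff[OF DERIV_ident DERIV_const, of a t UNIV]
      by (simp del: power_Suc of_nat_Suc)
    then have "((\<lambda>t. max 0 (t - a) ^ Suc (Suc k)) has_real_derivative real (Suc (Suc k)) * (t - a) ^ Suc k) (at t)"
      by (rule DERIV_cong_ev[THEN iffD1, rotated -1])
         (use 3 in \<open>auto intro!: eventually_mono[OF order_tendstoD(1)[OF tendsto_ident_at 3]]
            simp: eventually_nhds_conv_at\<close>)
    then show ?thesis using 3 by simp
  next
    case 2
    \<comment> \<open>Here the exponent has to be at least 2: at the kink the difference quotient is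
      dominated by |h|^(k+1), still a positive power.\<close>
    have "((\<lambda>h. max 0 h ^ Suc (Suc k) / h) \<longlongrightarrow> (0::real)) (at 0)"
    proof (rule tendsto_0_le[where K=1])
      show "((\<lambda>h::real. h ^ Suc k) \<longlongrightarrow> 0) (at 0)" by (rule tendsto_eq_intros | simp)+
      show "\<forall>\<^sub>F h::real in at 0. norm (max 0 h ^ Suc (Suc k) / h) \<le> norm (h ^ Suc k) * 1"
        by (auto simp: max_def)
    qed
    then show ?thesis using 2 by (simp add: DERIV_def)
  qed
qed

text \<open>The polynomial p(t) = t^4 (35 - 84 t + 70 t^2 - 20 t^3) satisfies p(t) + p(1 - t) = 1, so that
  p(t^+) + p(-(t - 1)^+) is constant outside [0,1].\<close>
lemma smooth_step_exists:
  obtains F F1 F2 F3 :: "real \<Rightarrow> real" and K :: real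
  where "\<And>t. (F has_real_derivative F1 t) (at t)"
    and "\<And>t. (F1 has_real_derivative F2 t) (at t)"
    and "\<And>t. (F2 has_real_derivative F3 t) (at t)"
    and "\<And>t. t \<le> 0 \<Longrightarrow> F t = 0 \<and> F1 t = 0 \<and> F2 t = 0"
    and "\<And>t. t \<ge> 1 \<Longrightarrow> F t = 1"
    and "\<And>t. 0 \<le> F t \<and> F t \<le> 1"
    and "\<And>t. \<bar>F1 t\<bar> \<le> K \<and> \<bar>F2 t\<bar> \<le> K \<and> \<bar>F3 t\<bar> \<le> K"
proof -
  define u v :: "real \<Rightarrow> real" where "u = (\<lambda>t. max 0 (t - 0))" and "v = (\<lambda>t. max 0 (t - 1))"
  have du: "((\<lambda>t. u t ^ k) has_real_derivative real k * u t ^ (k - 1)) (at t)" if "k \<ge> 2" for k t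
    using that DERIV_pos_part_power[of 0 "k - 2" t] by (auto simp: u_def Suc_diff_Suc numeral_2_eq_2)
  have dv: "((\<lambda>t. v t ^ k) has_real_derivative real k * v t ^ (k - 1)) (at t)" if "k \<ge> 2" for k t
    using that DERIV_pos_part_power[of 1 "k - 2" t] by (auto simp: v_def Suc_diff_Suc numeral_2_eq_2)
  \<comment> \<open>\<open>P\<close> is the normalised primitive of s^3 (1 - s)^3, with 140 = 7! /
    (3! 3!), and \<open>P1\<close>, \<open>P2\<close>, \<open>P3\<close> are its derivatives. The
    triple zeros of \<open>P1\<close> at both ends keep every power in \<open>P\<close>,
    \<open>P1\<close>, \<open>P2\<close> at least 2, which is what \<open>du\<close> and
    \<open>dv\<close> demand.\<close>
  define P :: "real \<Rightarrow> real" where "P = (\<lambda>s. 35 * s^4 - 84 * s^5 + 70 * s^6 - 20 * s^7)"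
  define P1 :: "real \<Rightarrow> real" where "P1 = (\<lambda>s. 140 * s^3 - 420 * s^4 + 420 * s^5 - 140 * s^6)"
  define P2 :: "real \<Rightarrow> real" where "P2 = (\<lambda>s. 420 * s^2 - 1680 * s^3 + 2100 * s^4 - 840 * s^5)"
  define P3 :: "real \<Rightarrow> real" where "P3 = (\<lambda>s. 840 * s - 5040 * s^2 + 8400 * s^3 - 4200 * s^4)"
  define F where "F = (\<lambda>t. P (u t) + P (- v t))"
  define F1 where "F1 = (\<lambda>t. P1 (u t) - P1 (- v t))"
  define F2 where "F2 = (\<lambda>t. P2 (u t) + P2 (- v t))"
  define F3 where "F3 = (\<lambda>t. P3 (u t) - P3 (- v t))"
  have low: "u t = 0" "v t = 0" if "t \<le> 0" for t using that by (auto simp: u_def v_def)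
  have mid: "u t = t" "v t = 0" if "0 \<le> t" "t \<le> 1" for t using that by (auto simp: u_def v_def)
  have high: "u t = t" "v t = t - 1" if "1 \<le> t" for t using that by (auto simp: u_def v_def)
  note dd = du[of 2, simplified] du[of 3, simplified] du[of 4, simplified] du[of 5, simplified]
    du[of 6, simplified] du[of 7, simplified] dv[of 2, simplified] dv[of 3, simplified]
    dv[of 4, simplified] dv[of 5, simplified] dv[of 6, simplified] dv[of 7, simplified]
  have 1: "(F has_real_derivative F1 t) (at t)" for t
    unfolding F_def P_def F1_def P1_def diff_conv_add_uminus power_minus[of "v _"]
    apply (rule DERIV_cong)
     apply (rule DERIV_add DERIV_minus DERIV_cmult dd)+
    apply simp
    done
  have 2: "(F1 has_real_derivative F2 t) (at t)" for t
    unfolding F2_def P2_def F1_def P1_def diff_conv_add_uminus power_minus[of "v _"]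
    apply (rule DERIV_cong)
     apply (rule DERIV_add DERIV_minus DERIV_cmult dd)+
    apply simp
    done
  have 3: "(F2 has_real_derivative F3 t) (at t)" for t
    unfolding F2_def P2_def F3_def P3_def diff_conv_add_uminus power_minus[of "v _"]
    apply (rule DERIV_cong)
     apply (rule DERIV_add DERIV_minus DERIV_cmult dd)+
    apply simp
    done
  have P0: "P 0 = 0" "P1 0 = 0" "P2 0 = 0" "P3 0 = 0" by (auto simp: P_def P1_def P2_def P3_def)
  have refl: "P t + P (1 - t) = 1" "P1 t = P1 (1 - t)" "P2 t = - P2 (1 - t)" "P3 t = P3 (1 - t)" for t
    unfolding P_def P1_def P2_def P3_def by algebra+
  have z: "F t = 0 \<and> F1 t = 0 \<and> F2 t = 0 \<and> F3 t = 0" if "t \<le> 0" for t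
    using low[OF that] by (simp add: F_def F1_def F2_def F3_def P0)
  have o: "F t = 1 \<and> F1 t = 0 \<and> F2 t = 0 \<and> F3 t = 0" if "t \<ge> 1" for t
    using high[OF that] refl[of t] by (simp add: F_def F1_def F2_def F3_def)
  have m: "F t = P t" "F1 t = P1 t" "F2 t = P2 t" "F3 t = P3 t" if "0 \<le> t" "t \<le> 1" for t
    using mid[OF that] by (auto simp: F_def F1_def F2_def F3_def P0)
  have F1nn: "F1 t \<ge> 0" for t
  proof -
    consider "t \<le> 0" | "t \<ge> 1" | "0 \<le> t" "t \<le> 1" by linarith
    then show ?thesis
    proof cases
      case 3
      have "P1 t = 140 * t^3 * (1-t)^3" unfolding P1_def by algebra
      then show ?thesis using m[OF 3] 3 by simp
    qed (use z o in auto)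
  qed
  have mono: "F s \<le> F t" if "s \<le> t" for s t
    by (rule DERIV_nonneg_imp_nondecreasing[OF that]) (use 1 F1nn in blast)
  have "0 \<le> F t \<and> F t \<le> 1" for t
    using mono[of "min t 0" t] mono[of t "max t 1"] z[of "min t 0"] o[of "max t 1"] by auto
  \<comment> \<open>On [0,1] each polynomial is at most the sum of its absolute coefficients; the
    largest such sum is 18480, for \<open>P3\<close>.\<close>
  moreover have "\<bar>F1 t\<bar> \<le> 20000 \<and> \<bar>F2 t\<bar> \<le> 20000 \<and> \<bar>F3 t\<bar> \<le> 20000" for t
  proof -
    consider "t \<le> 0" | "t \<ge> 1" | "0 \<le> t" "t \<le> 1" by linarith
    then show ?thesis
    proof cases
      case 3
      have "0 \<le> t^k \<and> t^k \<le> 1" for k using 3 by (simp add: power_le_one)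
      from this[of 2] this[of 3] this[of 4] this[of 5] this[of 6] this[of 1]
      show ?thesis unfolding m[OF 3] P1_def P2_def P3_def abs_le_iff power_one_right by (intro conjI; linarith)
    qed (use z o in auto)
  qed
  ultimately show ?thesis using that[of F F1 F2 F3 20000] 1 2 3 z o by blast
qed

text \<open>The step is rescaled to [a, a + d]; as d <= 1, the factor d^-3 of the third derivative
  dominates the lower ones and one constant serves all bounds. \<open>f1\<close> and
  \<open>f2\<close> are Taylor coefficients, so \<open>f2\<close> is half the second derivative. The
  remainder carries an indicator because w + |y| <= a puts both w and w + y in the region where f
  vanishes; these indicators are what later becomes the exponential weight.\<close>

lemma localized_smooth_step:
  obtains K :: real where "K > 0"
    and "\<And>a d::real. 0 < d \<Longrightarrow> d \<le> 1 \<Longrightarrow> \<exists>f f1 f2. f \<in> borel_measurable borel \<and>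
       (\<forall>w. 0 \<le> f w \<and> f w \<le> 1) \<and> (\<forall>w\<le>a. f w = 0) \<and> (\<forall>w\<ge>a+d. f w = 1) \<and>
       (\<forall>w. \<bar>f1 w\<bar> \<le> K / d^3 * indicator {a<..} w) \<and> (\<forall>w. \<bar>f2 w\<bar> \<le> K / d^3 * indicator {a<..} w) \<and>
       (\<forall>w y. \<bar>f (w + y) - f w - f1 w * y - f2 w * y\<^sup>2\<bar> \<le> K / d^3 * \<bar>y\<bar>^3 * indicator {a<..} (w + \<bar>y\<bar>))"
proof -
  obtain F F1 F2 F3 :: "real \<Rightarrow> real" and K :: real where
    D: "\<And>t. (F has_real_derivative F1 t) (at t)" "\<And>t. (F1 has_real_derivative F2 t) (at t)"
      "\<And>t. (F2 has_real_derivative F3 t) (at t)"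
    and z: "\<And>t. t \<le> 0 \<Longrightarrow> F t = 0 \<and> F1 t = 0 \<and> F2 t = 0"
    and o: "\<And>t. t \<ge> 1 \<Longrightarrow> F t = 1"
    and b: "\<And>t. 0 \<le> F t \<and> F t \<le> 1"
    and K: "\<And>t. \<bar>F1 t\<bar> \<le> K \<and> \<bar>F2 t\<bar> \<le> K \<and> \<bar>F3 t\<bar> \<le> K"
    by (rule smooth_step_exists) blast
  have K0: "K \<ge> 0" using K[of 0] by linarith
  have taylor: "\<bar>F (s + r) - F s - F1 s * r - F2 s / 2 * r\<^sup>2\<bar> \<le> K * \<bar>r\<bar>^3" for s r
  proof (cases "r = 0")
    case False
    define df where "df m = (if m = 0 then F else if m = 1 then F1 else if m = 2 then F2 else F3)" for m :: nat
    have "\<exists>t. (if s + r < s then s + r < t \<and> t < s else s < t \<and> t < s + r) \<and>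
       F (s + r) = (\<Sum>m<3. (df m s / fact m) * (s + r - s)^m) + (df 3 t / fact 3) * (s + r - s)^3"
    proof (rule Taylor[where a = "s - \<bar>r\<bar>" and b = "s + \<bar>r\<bar>"])
      show "\<forall>m t. m < 3 \<and> s - \<bar>r\<bar> \<le> t \<and> t \<le> s + \<bar>r\<bar> \<longrightarrow> (df m has_real_derivative df (Suc m) t) (at t)"
        using D by (auto simp: df_def less_Suc_eq numeral_3_eq_3 numeral_2_eq_2)
    qed (use False in \<open>auto simp: df_def\<close>)
    then obtain t where "F (s + r) = F s + F1 s * r + F2 s / 2 * r^2 + F3 t / 6 * r^3"
      by (auto simp: df_def eval_nat_numeral)
    then have "\<bar>F (s + r) - F s - F1 s * r - F2 s / 2 * r\<^sup>2\<bar> = \<bar>F3 t\<bar> / 6 * \<bar>r\<bar>^3"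
      by (simp add: abs_mult power_abs)
    also have "\<dots> \<le> K * \<bar>r\<bar>^3" using K[of t] K0 by (intro mult_right_mono) auto
    finally show ?thesis .
  qed simp
  show thesis
  \<comment> \<open>\<open>K\<close> is only known to be nonnegative, while a positive constant is
    promised.\<close>
  proof (rule that[of "K + 1"])
    fix a d :: real assume d: "0 < d" "d \<le> 1"
    define g where "g w = (w - a) / d" for w
    define f f1 f2 where "f = (\<lambda>w. F (g w))" and "f1 = (\<lambda>w. F1 (g w) / d)" and "f2 = (\<lambda>w. F2 (g w) / (2 * d^2))"
    have gle: "g w \<le> 0" if "w \<le> a" for w using that d by (simp add: g_def divide_le_0_iff)
    have gge: "g w \<ge> 1" if "w \<ge> a + d" for w using that d by (simp add: g_def le_divide_eq)
    have "continuous_on UNIV F" using D(1) DERIV_isCont continuous_at_imp_continuous_on by blast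
    from borel_measurable_continuous_onI[OF this] have [measurable]: "F \<in> borel_measurable borel" .
    have fm: "f \<in> borel_measurable borel" unfolding f_def g_def by measurable
    have f01: "\<forall>w. 0 \<le> f w \<and> f w \<le> 1" "\<forall>w\<le>a. f w = 0" "\<forall>w\<ge>a+d. f w = 1"
      using b z[OF gle] o[OF gge] by (auto simp: f_def)
    have dd: "K * (1 / d) \<le> (K + 1) / d^3" "K * (1 / (2 * d^2)) \<le> (K + 1) / d^3"
    proof -
      have "d ^ 3 \<le> d ^ 1" "d ^ 3 \<le> d^2" using d by (intro power_decreasing; simp)+
      moreover from this have "d ^ 3 \<le> 2 * d^2" using zero_le_power2[of d] by linarith
      ultimately have "1 / d \<le> 1 / d^3" "1 / (2 * d^2) \<le> 1 / d^3" using d by (auto intro!: divide_left_mono) 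
      then have "K * (1 / d) \<le> K * (1 / d^3)" "K * (1 / (2 * d^2)) \<le> K * (1 / d^3)"
        using K0 mult_left_mono by blast+
      moreover have "K * (1 / d^3) \<le> (K + 1) / d^3" using d by (simp add: divide_right_mono)
      ultimately show "K * (1 / d) \<le> (K + 1) / d^3" "K * (1 / (2 * d^2)) \<le> (K + 1) / d^3" by linarith+
    qed
    have "\<bar>f1 w\<bar> \<le> (K + 1) / d^3 * indicator {a<..} w" for w
    proof (cases "w \<le> a")
      case True then show ?thesis using z[OF gle[OF True]] by (simp add: f1_def)
    next
      case False
      have "\<bar>f1 w\<bar> = \<bar>F1 (g w)\<bar> * (1 / d)" using d by (simp add: f1_def)
      also have "\<dots> \<le> K * (1 / d)" using K d by (intro mult_right_mono) auto
      also note dd(1) finally show ?thesis using False by simp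
    qed
    moreover have "\<bar>f2 w\<bar> \<le> (K + 1) / d^3 * indicator {a<..} w" for w
    proof (cases "w \<le> a")
      case True then show ?thesis using z[OF gle[OF True]] by (simp add: f2_def)
    next
      case False
      have "\<bar>f2 w\<bar> = \<bar>F2 (g w)\<bar> * (1 / (2 * d^2))" using d by (simp add: f2_def abs_mult)
      also have "\<dots> \<le> K * (1 / (2 * d^2))" using K d by (intro mult_right_mono) auto
      also note dd(2) finally show ?thesis using False by simp
    qed
    moreover have "\<bar>f (w + y) - f w - f1 w * y - f2 w * y\<^sup>2\<bar>
        \<le> (K + 1) / d^3 * \<bar>y\<bar>^3 * indicator {a<..} (w + \<bar>y\<bar>)" for w y
    proof (cases "w + \<bar>y\<bar> \<le> a")
      case True
      then have "g w \<le> 0" "g (w + y) \<le> 0" by (auto intro!: gle)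
      then show ?thesis using z True by (simp add: f_def f1_def f2_def)
    next
      case False
      have "g (w + y) = g w + y / d" by (simp add: g_def diff_divide_distrib add_divide_distrib)
      then have "\<bar>f (w + y) - f w - f1 w * y - f2 w * y\<^sup>2\<bar> \<le> K * \<bar>y / d\<bar>^3"
        using taylor[of "g w" "y / d"] by (simp add: f_def f1_def f2_def power_divide mult.commute)
      also have "\<dots> \<le> (K + 1) * \<bar>y / d\<bar>^3" by (intro mult_right_mono) auto
      also have "\<dots> = (K + 1) / d^3 * \<bar>y\<bar>^3" using d by (simp add: power_divide)
      finally show ?thesis using False by simp
    qed
    ultimately show "\<exists>f f1 f2. f \<in> borel_measurable borel \<and>
       (\<forall>w. 0 \<le> f w \<and> f w \<le> 1) \<and> (\<forall>w\<le>a. f w = 0) \<and> (\<forall>w\<ge>a+d. f w = 1) \<and>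
       (\<forall>w. \<bar>f1 w\<bar> \<le> (K + 1) / d^3 * indicator {a<..} w) \<and> (\<forall>w. \<bar>f2 w\<bar> \<le> (K + 1) / d^3 * indicator {a<..} w) \<and>
       (\<forall>w y. \<bar>f (w + y) - f w - f1 w * y - f2 w * y\<^sup>2\<bar> \<le> (K + 1) / d^3 * \<bar>y\<bar>^3 * indicator {a<..} (w + \<bar>y\<bar>))"
      using fm f01 by blast
  qed (use K0 in simp)
qed

subsection \<open>Smearing operators\<close>

text \<open>The operator form of convolution: the n-th iterate at w is the expectation of f at w
  plus n independent copies. Replacing summands becomes telescoping in an algebra of commuting
  operators, without hybrid sums on a common probability space.\<close>

definition smear :: "real measure \<Rightarrow> (real \<Rightarrow> real) \<Rightarrow> real \<Rightarrow> real" where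
  "smear \<mu> f w = (\<integral>y. f (w + y) \<partial>\<mu>)"

definition bounded_borel :: "(real \<Rightarrow> real) \<Rightarrow> bool" where
  "bounded_borel f \<longleftrightarrow> f \<in> borel_measurable borel \<and> (\<exists>B. \<forall>w. \<bar>f w\<bar> \<le> B)"

lemma bounded_borel_measurable: "bounded_borel f \<Longrightarrow> f \<in> borel_measurable borel"
  by (simp add: bounded_borel_def)

lemma bounded_borel_diff:
  assumes "bounded_borel f" "bounded_borel g"
  shows "bounded_borel (\<lambda>w. f w - g w)"
proof -
  obtain A B where AB: "\<And>w. \<bar>f w\<bar> \<le> A" "\<And>w. \<bar>g w\<bar> \<le> B" using assms by (auto simp: bounded_borel_def)
  have "\<bar>f w - g w\<bar> \<le> A + B" for w using AB[of w] by linarith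
  then show ?thesis using assms by (auto simp: bounded_borel_def)
qed

context real_distribution
begin

lemma integrable_bounded_borel:
  assumes "bounded_borel f" shows "integrable M (\<lambda>y. f (w + y))"
proof -
  obtain B where B: "\<And>w. \<bar>f w\<bar> \<le> B" using assms by (auto simp: bounded_borel_def)
  show ?thesis
    using B bounded_borel_measurable[OF assms] by (intro integrable_const_bound[where B = B]) auto
qed

lemma bounded_borel_smear:
  assumes "bounded_borel f" shows "bounded_borel (smear M f)"
proof -
  obtain B where B: "\<And>w. \<bar>f w\<bar> \<le> B" using assms by (auto simp: bounded_borel_def)
  note [measurable] = bounded_borel_measurable[OF assms]
  have "\<bar>smear M f w\<bar> \<le> B" for w
  proof -
    have "\<bar>smear M f w\<bar> \<le> (\<integral>y. \<bar>f (w + y)\<bar> \<partial>M)" unfolding smear_def by (rule integral_abs_bound)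
    also have "\<dots> \<le> (\<integral>y. B \<partial>M)"
      using B integrable_bounded_borel[OF assms] by (intro integral_mono) auto
    finally show ?thesis using prob_space by simp
  qed
  moreover have "smear M f \<in> borel_measurable borel"
    unfolding smear_def[abs_def] by (rule borel_measurable_lebesgue_integral) measurable
  ultimately show ?thesis by (auto simp: bounded_borel_def)
qed

lemma bounded_borel_smear_iterate:
  assumes "bounded_borel f" shows "bounded_borel ((smear M ^^ n) f)"
  by (induction n) (auto simp: assms bounded_borel_smear)

lemma smear_diff:
  assumes "bounded_borel f" "bounded_borel g"
  shows "smear M (\<lambda>w. f w - g w) = (\<lambda>w. smear M f w - smear M g w)"
  using assms by (simp add: smear_def fun_eq_iff integrable_bounded_borel)

lemma smear_iterate_diff:
  assumes "bounded_borel f" "bounded_borel g"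
  shows "(smear M ^^ n) (\<lambda>w. f w - g w) = (\<lambda>w. (smear M ^^ n) f w - (smear M ^^ n) g w)"
  by (induction n) (simp_all add: smear_diff bounded_borel_smear_iterate assms)

text \<open>The weight exp (h w) is an eigenfunction of smearing, with the exponential moment as
  eigenvalue; positivity of the operator transfers this to anything the weight dominates.\<close>

lemma smear_exp_bound:
  assumes f: "bounded_borel f" and b: "\<And>w. \<bar>f w\<bar> \<le> c * exp (h * w)"
    and i: "integrable M (\<lambda>y. exp (h * y))" and m: "(\<integral>y. exp (h * y) \<partial>M) \<le> m"
  shows "\<bar>smear M f w\<bar> \<le> c * m * exp (h * w)"
proof -
  have c: "0 \<le> c" using b[of 0] by simp
  have "\<bar>smear M f w\<bar> \<le> (\<integral>y. \<bar>f (w + y)\<bar> \<partial>M)" unfolding smear_def by (rule integral_abs_bound)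
  also have "\<dots> \<le> (\<integral>y. (c * exp (h * w)) * exp (h * y) \<partial>M)"
    using b[of "w + _"] i integrable_bounded_borel[OF f]
    by (intro integral_mono) (auto simp: distrib_left exp_add mult_ac)
  also have "\<dots> = (c * exp (h * w)) * (\<integral>y. exp (h * y) \<partial>M)" by simp
  also have "\<dots> \<le> (c * exp (h * w)) * m" using c m by (intro mult_left_mono) auto
  finally show ?thesis by (simp add: mult_ac)
qed

lemma smear_iterate_exp_bound:
  assumes f: "bounded_borel f" and b: "\<And>w. \<bar>f w\<bar> \<le> c * exp (h * w)"
    and i: "integrable M (\<lambda>y. exp (h * y))" and m: "(\<integral>y. exp (h * y) \<partial>M) \<le> m"
  shows "\<bar>(smear M ^^ n) f w\<bar> \<le> c * m ^ n * exp (h * w)"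
proof (induction n arbitrary: w)
  case (Suc n)
  have "\<bar>smear M ((smear M ^^ n) f) w\<bar> \<le> (c * m ^ n) * m * exp (h * w)"
    by (rule smear_exp_bound[OF bounded_borel_smear_iterate[OF f] Suc i m])
  then show ?case by (simp add: mult_ac)
qed (use b in simp)

end

text \<open>Fubini and commutativity of addition. Commuting lets every exchange act directly on the
  original smooth f, the only function for which Taylor bounds are available.\<close>

lemma smear_commute:
  assumes "real_distribution \<mu>" "real_distribution \<nu>" and f: "bounded_borel f"
  shows "smear \<mu> (smear \<nu> f) = smear \<nu> (smear \<mu> f)"
proof
  fix w
  interpret M: real_distribution \<mu> by fact
  interpret N: real_distribution \<nu> by fact
  interpret P: pair_prob_space \<mu> \<nu> ..
  note [measurable] = bounded_borel_measurable[OF f]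
  obtain B where B: "\<And>w. \<bar>f w\<bar> \<le> B" using f by (auto simp: bounded_borel_def)
  have "integrable (\<mu> \<Otimes>\<^sub>M \<nu>) (case_prod (\<lambda>x y. f (w + x + y)))"
    using B by (intro P.P.integrable_const_bound[where B = B]) auto
  from P.Fubini_integral[OF this] show "smear \<mu> (smear \<nu> f) w = smear \<nu> (smear \<mu> f) w"
    by (simp add: smear_def add_ac)
qed

lemma smear_iterate_commute:
  assumes "real_distribution \<mu>" "real_distribution \<nu>" "bounded_borel f"
  shows "smear \<mu> ((smear \<nu> ^^ n) f) = (smear \<nu> ^^ n) (smear \<mu> f)"
proof (induction n)
  case (Suc n)
  show ?case
    using Suc smear_commute[OF assms(1,2) real_distribution.bounded_borel_smear_iterate[OF assms(2,3)]]
    by simp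
qed simp

text \<open>Lindeberg's replacement argument in the norm weighted by exp (h w).\<close>
lemma smear_iterate_compare:
  assumes "real_distribution \<mu>" "real_distribution \<nu>" and f: "bounded_borel f"
    and step: "\<And>w. \<bar>smear \<mu> f w - smear \<nu> f w\<bar> \<le> D * exp (h * w)"
    and i: "integrable \<mu> (\<lambda>y. exp (h * y))" "integrable \<nu> (\<lambda>y. exp (h * y))"
    and m: "(\<integral>y. exp (h * y) \<partial>\<mu>) \<le> m" "(\<integral>y. exp (h * y) \<partial>\<nu>) \<le> m" "1 \<le> m"
  shows "\<bar>(smear \<mu> ^^ n) f w - (smear \<nu> ^^ n) f w\<bar> \<le> real n * D * m ^ n * exp (h * w)"
proof (induction n arbitrary: w)
  case (Suc n)
  interpret M: real_distribution \<mu> by fact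
  interpret N: real_distribution \<nu> by fact
  have D: "0 \<le> D" using step[of 0] by simp
  let ?A = "(smear \<mu> ^^ n) f" and ?B = "(smear \<nu> ^^ n) f"
  have bA: "bounded_borel ?A" and bB: "bounded_borel ?B"
    using f M.bounded_borel_smear_iterate N.bounded_borel_smear_iterate by auto
  \<comment> \<open>With U and V for smearing by \<open>\<mu>\<close> and \<open>\<nu>\<close>, the
    telescoping is U^(n+1) f - V^(n+1) f = U (U^n f - V^n f) + V^n (U f - V f). The first term is
    the induction hypothesis smeared once more, the second the one-step error smeared n times; 1 <=
    m brings both to the same power of m.\<close>
  have "\<bar>smear \<mu> (\<lambda>w. ?A w - ?B w) w\<bar> \<le> real n * D * m ^ n * m * exp (h * w)"
    by (rule M.smear_exp_bound[OF bounded_borel_diff[OF bA bB] Suc i(1) m(1)])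
  then have 1: "\<bar>smear \<mu> ?A w - smear \<mu> ?B w\<bar> \<le> real n * D * m ^ Suc n * exp (h * w)"
    by (simp add: M.smear_diff[OF bA bB] mult_ac)
  have "\<bar>(smear \<nu> ^^ n) (\<lambda>w. smear \<mu> f w - smear \<nu> f w) w\<bar> \<le> D * m ^ n * exp (h * w)"
    by (rule N.smear_iterate_exp_bound[OF bounded_borel_diff step i(2) m(2)])
       (simp_all add: f M.bounded_borel_smear N.bounded_borel_smear)
  then have "\<bar>smear \<mu> ?B w - smear \<nu> ?B w\<bar> \<le> D * m ^ n * exp (h * w)"
    by (simp add: N.smear_iterate_diff f M.bounded_borel_smear N.bounded_borel_smear
        smear_iterate_commute[OF assms(1,2)] smear_iterate_commute[OF assms(2,2)])
  also have "\<dots> \<le> D * m ^ Suc n * exp (h * w)"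
    using D m(3) by (intro mult_right_mono mult_left_mono power_increasing) auto
  finally show ?case using 1 by (simp add: algebra_simps)
qed simp

text \<open>The only place where independence is turned into analysis: the joint law of one summand
  and the sum of the others is a product measure. The induction varies f, since peeling off a
  summand replaces f by its smear.\<close>

lemma (in prob_space) expectation_sum_eq_smear:
  fixes Y :: "'i \<Rightarrow> 'a \<Rightarrow> real"
  assumes "finite I" "indep_vars (\<lambda>_. borel) Y I" "\<And>i. i \<in> I \<Longrightarrow> distr M borel (Y i) = \<mu>"
    and "real_distribution \<mu>" "bounded_borel f"
  shows "expectation (\<lambda>\<omega>. f (w + (\<Sum>i\<in>I. Y i \<omega>))) = (smear \<mu> ^^ card I) f w"
  using assms
proof (induction I arbitrary: f rule: finite_induct)
  case empty
  then show ?case using prob_space by simp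
next
  case (insert i I)
  interpret R: real_distribution \<mu> by fact
  let ?T = "\<lambda>\<omega>. \<Sum>i\<in>I. Y i \<omega>"
  have iv: "indep_var borel (Y i) borel ?T"
    using insert by (intro indep_vars_sum) auto
  then have [measurable]: "Y i \<in> borel_measurable M" "?T \<in> borel_measurable M"
    by (auto simp: indep_var_eq)
  note [measurable] = bounded_borel_measurable[OF insert.prems(4)]
  interpret T: prob_space "distr M borel ?T" by (rule prob_space_distr) simp
  interpret P: pair_prob_space \<mu> "distr M borel ?T" ..
  have J: "distr M (borel \<Otimes>\<^sub>M borel) (\<lambda>\<omega>. (Y i \<omega>, ?T \<omega>)) = \<mu> \<Otimes>\<^sub>M distr M borel ?T"
    using iv insert.prems(2)[of i] by (simp add: indep_var_distribution_eq)
  obtain B where B: "\<And>w. \<bar>f w\<bar> \<le> B" using insert.prems(4) by (auto simp: bounded_borel_def)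
  have int: "integrable (\<mu> \<Otimes>\<^sub>M distr M borel ?T) (case_prod (\<lambda>x y. f (w + (x + y))))"
    using B by (intro P.P.integrable_const_bound[where B = B]) auto
  have "expectation (\<lambda>\<omega>. f (w + (\<Sum>i\<in>insert i I. Y i \<omega>)))
      = (\<integral>z. f (w + (fst z + snd z)) \<partial>distr M (borel \<Otimes>\<^sub>M borel) (\<lambda>\<omega>. (Y i \<omega>, ?T \<omega>)))"
    using insert by (subst integral_distr) auto
  also have "\<dots> = (\<integral>t. \<integral>y. f (w + (y + t)) \<partial>\<mu> \<partial>distr M borel ?T)"
    unfolding J using P.integral_snd[OF int] by (simp add: case_prod_unfold)
  also have "\<dots> = (\<integral>t. smear \<mu> f (w + t) \<partial>distr M borel ?T)" by (simp add: smear_def add_ac)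
  also have "\<dots> = expectation (\<lambda>\<omega>. smear \<mu> f (w + ?T \<omega>))"
    using bounded_borel_measurable[OF R.bounded_borel_smear[OF insert.prems(4)]]
    by (subst integral_distr) auto
  also have "\<dots> = (smear \<mu> ^^ card I) (smear \<mu> f) w"
    using insert R.bounded_borel_smear by (intro insert.IH) (auto intro: indep_vars_subset)
  finally show ?case using insert by (simp add: funpow_swap1)
qed

section \<open>Taylor estimates for a single summand\<close>

lemma exp_le_second_order:
  fixes t :: real shows "exp t \<le> 1 + t + t\<^sup>2 / 2 + \<bar>t\<bar> ^ 3 * exp \<bar>t\<bar>"
proof -
  obtain s where s: "\<bar>s\<bar> \<le> \<bar>t\<bar>" "exp t = (\<Sum>m<3. t ^ m / fact m) + exp s / fact 3 * t ^ 3"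
    using Maclaurin_exp_le[of t 3] by blast
  have "exp s / fact 3 * t ^ 3 \<le> \<bar>exp s / fact 3 * t ^ 3\<bar>" by (rule abs_ge_self)
  also have "\<dots> = exp s / fact 3 * \<bar>t\<bar> ^ 3" by (simp add: abs_mult power_abs)
  also have "\<dots> \<le> exp \<bar>t\<bar> * \<bar>t\<bar> ^ 3"
  proof (rule mult_right_mono)
    have "exp s / fact 3 \<le> exp s" by (simp add: divide_le_eq fact_numeral)
    also have "\<dots> \<le> exp \<bar>t\<bar>" using s(1) by simp
    finally show "exp s / fact 3 \<le> exp \<bar>t\<bar>" .
  qed simp
  finally show ?thesis using s(2) by (simp add: eval_nat_numeral mult_ac)
qed

context real_distribution
begin

lemma integrable_of_weighted_third_moment:
  assumes "h \<ge> 0" and i: "integrable M (\<lambda>y. \<bar>y\<bar> ^ 3 * exp (h * \<bar>y\<bar>))"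
  shows "integrable M (\<lambda>y. y)" "integrable M (\<lambda>y. y\<^sup>2)"
proof -
  have *: "\<bar>y\<bar> \<le> 1 + \<bar>y\<bar> ^ 3 * exp (h * \<bar>y\<bar>) \<and> y\<^sup>2 \<le> 1 + \<bar>y\<bar> ^ 3 * exp (h * \<bar>y\<bar>)" for y :: real
  proof -
    have "\<bar>y\<bar> ^ 3 * 1 \<le> \<bar>y\<bar> ^ 3 * exp (h * \<bar>y\<bar>)" using assms by (intro mult_left_mono) auto
    moreover have "\<bar>y\<bar> \<le> 1 + \<bar>y\<bar> ^ 3 \<and> \<bar>y\<bar> ^ 2 \<le> 1 + \<bar>y\<bar> ^ 3"
    proof (cases "\<bar>y\<bar> \<le> 1")
      case True
      then have "\<bar>y\<bar> ^ 2 \<le> 1" by (intro power_le_one) auto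
      then show ?thesis using True zero_le_power[of "\<bar>y\<bar>" 3] by linarith
    next
      case False
      then have "\<bar>y\<bar> ^ 1 \<le> \<bar>y\<bar> ^ 3" "\<bar>y\<bar> ^ 2 \<le> \<bar>y\<bar> ^ 3" by (intro power_increasing; simp)+
      then show ?thesis by simp
    qed
    ultimately show ?thesis by (auto simp del: abs_le_iff)
  qed
  have b: "integrable M (\<lambda>y. 1 + \<bar>y\<bar> ^ 3 * exp (h * \<bar>y\<bar>))" using i by simp
  show "integrable M (\<lambda>y. y)"
    by (rule Bochner_Integration.integrable_bound[OF b]) (use * in \<open>auto intro!: order_trans[OF _ abs_ge_self]\<close>)
  show "integrable M (\<lambda>y. y\<^sup>2)"
    by (rule Bochner_Integration.integrable_bound[OF b]) (use * in \<open>auto intro!: order_trans[OF _ abs_ge_self]\<close>)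
qed

text \<open>A second-order expansion of the exponential followed by 1 + u <= exp u. The exponential
  form makes n-th powers harmless, since they only multiply the exponent by n. The mean stays in the
  bound because truncated summands are not centered.\<close>

lemma exp_moment_bound:
  assumes h: "h \<ge> 0" and i: "integrable M (\<lambda>y. \<bar>y\<bar> ^ 3 * exp (h * \<bar>y\<bar>))"
  shows "integrable M (\<lambda>y. exp (h * y))"
    and "(\<integral>y. exp (h * y) \<partial>M) \<le> exp (h * (\<integral>y. y \<partial>M) + h\<^sup>2 / 2 * (\<integral>y. y\<^sup>2 \<partial>M)
           + h ^ 3 * (\<integral>y. \<bar>y\<bar> ^ 3 * exp (h * \<bar>y\<bar>) \<partial>M))"
proof -
  note i2 = integrable_of_weighted_third_moment[OF assms]
  let ?g = "\<lambda>y. 1 + h * y + h\<^sup>2 / 2 * y\<^sup>2 + h ^ 3 * (\<bar>y\<bar> ^ 3 * exp (h * \<bar>y\<bar>))"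
  have le: "exp (h * y) \<le> ?g y" for y
    using exp_le_second_order[of "h * y"] h by (simp add: abs_mult power_mult_distrib mult_ac)
  have ig: "integrable M ?g" using i i2 by simp
  show ie: "integrable M (\<lambda>y. exp (h * y))"
    by (rule Bochner_Integration.integrable_bound[OF ig]) (use le in \<open>auto intro!: order_trans[OF _ abs_ge_self]\<close>)
  have "(\<integral>y. exp (h * y) \<partial>M) \<le> (\<integral>y. ?g y \<partial>M)" by (intro integral_mono ie ig le)
  also have "\<dots> = 1 + (h * (\<integral>y. y \<partial>M) + h\<^sup>2 / 2 * (\<integral>y. y\<^sup>2 \<partial>M)
           + h ^ 3 * (\<integral>y. \<bar>y\<bar> ^ 3 * exp (h * \<bar>y\<bar>) \<partial>M))"
    using i i2 prob_space by simp
  also have "\<dots> \<le> exp (h * (\<integral>y. y \<partial>M) + h\<^sup>2 / 2 * (\<integral>y. y\<^sup>2 \<partial>M)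
           + h ^ 3 * (\<integral>y. \<bar>y\<bar> ^ 3 * exp (h * \<bar>y\<bar>) \<partial>M))" by (rule exp_ge_add_one_self)
  finally show "(\<integral>y. exp (h * y) \<partial>M) \<le> \<dots>" .
qed

lemma smear_taylor:
  assumes h: "h \<ge> 0" and i: "integrable M (\<lambda>y. \<bar>y\<bar> ^ 3 * exp (h * \<bar>y\<bar>))"
    and f: "bounded_borel f" and L: "L \<ge> 0"
    and taylor: "\<And>y. \<bar>f (w + y) - f w - f1 * y - f2 * y\<^sup>2\<bar> \<le> L * \<bar>y\<bar> ^ 3 * indicator {a<..} (w + \<bar>y\<bar>)"
  shows "\<bar>smear M f w - f w - f1 * (\<integral>y. y \<partial>M) - f2 * (\<integral>y. y\<^sup>2 \<partial>M)\<bar>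
     \<le> L * (\<integral>y. \<bar>y\<bar> ^ 3 * exp (h * \<bar>y\<bar>) \<partial>M) * exp (h * (w - a))"
proof -
  note i2 = integrable_of_weighted_third_moment[OF h i]
  note if_ = integrable_bounded_borel[OF f, of w]
  have ir: "integrable M (\<lambda>y. f (w + y) - f w - f1 * y - f2 * y\<^sup>2)"
    using if_ i2 by simp
  have "smear M f w - f w - f1 * (\<integral>y. y \<partial>M) - f2 * (\<integral>y. y\<^sup>2 \<partial>M)
      = (\<integral>y. f (w + y) - f w - f1 * y - f2 * y\<^sup>2 \<partial>M)"
    using if_ i2 prob_space by (simp add: smear_def)
  also have "\<bar>\<dots>\<bar> \<le> (\<integral>y. \<bar>f (w + y) - f w - f1 * y - f2 * y\<^sup>2\<bar> \<partial>M)" by (rule integral_abs_bound)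
  also have "\<dots> \<le> (\<integral>y. (L * exp (h * (w - a))) * (\<bar>y\<bar> ^ 3 * exp (h * \<bar>y\<bar>)) \<partial>M)"
  proof (intro integral_mono)
    fix y
    \<comment> \<open>The support condition is traded for the weight: where w + |y| exceeds a, the
      exponential is at least 1.\<close>
    have "indicator {a<..} (w + \<bar>y\<bar>) \<le> exp (h * (w + \<bar>y\<bar> - a))"
      using h by (auto simp: indicator_def)
    then have "L * \<bar>y\<bar> ^ 3 * indicator {a<..} (w + \<bar>y\<bar>) \<le> L * \<bar>y\<bar> ^ 3 * exp (h * (w + \<bar>y\<bar> - a))"
      using L by (intro mult_left_mono) auto
    also have "\<dots> = (L * exp (h * (w - a))) * (\<bar>y\<bar> ^ 3 * exp (h * \<bar>y\<bar>))"
      by (simp add: algebra_simps flip: exp_add)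
    finally show "\<bar>f (w + y) - f w - f1 * y - f2 * y\<^sup>2\<bar> \<le> \<dots>" using taylor[of y] by linarith
  qed (use ir i in auto)
  also have "\<dots> = (L * exp (h * (w - a))) * (\<integral>y. \<bar>y\<bar> ^ 3 * exp (h * \<bar>y\<bar>) \<partial>M)"
    by (rule integral_mult_right_zero)
  finally show ?thesis by (simp add: mult_ac)
qed

end

lemma smear_one_step:
  assumes "real_distribution \<mu>" "real_distribution \<nu>" and h: "h \<ge> 0"
    and i: "integrable \<mu> (\<lambda>y. \<bar>y\<bar> ^ 3 * exp (h * \<bar>y\<bar>))" "integrable \<nu> (\<lambda>y. \<bar>y\<bar> ^ 3 * exp (h * \<bar>y\<bar>))"
    and f: "bounded_borel f" and L: "L \<ge> 0"
    and f12: "\<And>w. \<bar>f1 w\<bar> \<le> L * indicator {a<..} w" "\<And>w. \<bar>f2 w\<bar> \<le> L * indicator {a<..} w"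
    and taylor: "\<And>w y. \<bar>f (w + y) - f w - f1 w * y - f2 w * y\<^sup>2\<bar> \<le> L * \<bar>y\<bar> ^ 3 * indicator {a<..} (w + \<bar>y\<bar>)"
  shows "\<bar>smear \<mu> f w - smear \<nu> f w\<bar> \<le> L * (\<bar>(\<integral>y. y \<partial>\<mu>) - (\<integral>y. y \<partial>\<nu>)\<bar> + \<bar>(\<integral>y. y\<^sup>2 \<partial>\<mu>) - (\<integral>y. y\<^sup>2 \<partial>\<nu>)\<bar>
      + (\<integral>y. \<bar>y\<bar> ^ 3 * exp (h * \<bar>y\<bar>) \<partial>\<mu>) + (\<integral>y. \<bar>y\<bar> ^ 3 * exp (h * \<bar>y\<bar>) \<partial>\<nu>)) * exp (h * (w - a))"
proof -
  let ?e = "exp (h * (w - a))"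
  have ind: "L * indicator {a<..} w \<le> L * ?e"
    using L h by (intro mult_left_mono) (auto simp: indicator_def)
  have f12': "\<bar>f1 w\<bar> \<le> L * ?e" "\<bar>f2 w\<bar> \<le> L * ?e" using f12[of w] ind by linarith+
  have a: "\<bar>f1 w * r\<bar> \<le> L * ?e * \<bar>r\<bar>" "\<bar>f2 w * r\<bar> \<le> L * ?e * \<bar>r\<bar>" for r
    unfolding abs_mult by (intro mult_right_mono f12' abs_ge_zero)+
  note real_distribution.smear_taylor[OF assms(1) h i(1) f L taylor[of w]]
    real_distribution.smear_taylor[OF assms(2) h i(2) f L taylor[of w]]
    a(1)[of "(\<integral>y. y \<partial>\<mu>) - (\<integral>y. y \<partial>\<nu>)"] a(2)[of "(\<integral>y. y\<^sup>2 \<partial>\<mu>) - (\<integral>y. y\<^sup>2 \<partial>\<nu>)"]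
  then show ?thesis by (simp add: algebra_simps) 
qed

subsection \<open>The normal distribution\<close>

definition std_normal :: "real measure" where
  "std_normal = density lborel std_normal_density"

lemma real_distribution_std_normal: "real_distribution std_normal"
  unfolding std_normal_def real_distribution_def real_distribution_axioms_def
  by (auto simp: prob_space_normal_density)

lemma sets_std_normal[measurable_cong, simp]: "sets std_normal = sets borel"
  by (simp add: std_normal_def)

lemma integrable_std_normal_iff:
  fixes g :: "real \<Rightarrow> real"
  assumes [measurable]: "g \<in> borel_measurable borel"
  shows "integrable std_normal g \<longleftrightarrow> integrable lborel (\<lambda>z. std_normal_density z * g z)"
  unfolding std_normal_def by (subst integrable_density) auto

lemma integral_std_normal:
  fixes g :: "real \<Rightarrow> real"
  assumes [measurable]: "g \<in> borel_measurable borel"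
  shows "(\<integral>z. g z \<partial>std_normal) = (\<integral>z. std_normal_density z * g z \<partial>lborel)"
  unfolding std_normal_def by (subst integral_density) auto

lemma integrable_std_normal_exp: "integrable std_normal (\<lambda>z. exp (c * z))"
proof -
  have "std_normal_density z * exp (c * z) = exp (c\<^sup>2 / 2) * normal_density c 1 z" for z
    by (simp add: normal_density_def power2_eq_square field_simps flip: exp_add)
  then show ?thesis by (simp add: integrable_std_normal_iff)
qed

lemma integrable_std_normal_third: "integrable std_normal (\<lambda>z. \<bar>z\<bar> ^ 3 * exp \<bar>z\<bar>)"
proof (rule Bochner_Integration.integrable_bound)
  show "integrable std_normal (\<lambda>z. 27 * (exp (2 * z) + exp (- 2 * z)))"
    using integrable_std_normal_exp[of 2] integrable_std_normal_exp[of "-2"] by simp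
  \<comment> \<open>The constant 27 comes from cubing u <= exp u at u = |z| / 3.\<close>
  have "\<bar>z\<bar> ^ 3 * exp \<bar>z\<bar> \<le> 27 * (exp (2 * z) + exp (- 2 * z))" for z :: real
  proof -
    have "\<bar>z\<bar> / 3 \<le> exp (\<bar>z\<bar> / 3)" using exp_ge_add_one_self[of "\<bar>z\<bar> / 3"] by linarith
    then have "(\<bar>z\<bar> / 3) ^ 3 \<le> exp (\<bar>z\<bar> / 3) ^ 3" by (intro power_mono) auto
    also have "\<dots> = exp \<bar>z\<bar>" by (simp flip: exp_of_nat_mult)
    finally have "\<bar>z\<bar> ^ 3 \<le> 27 * exp \<bar>z\<bar>" by (simp add: power_divide)
    then have "\<bar>z\<bar> ^ 3 * exp \<bar>z\<bar> \<le> (27 * exp \<bar>z\<bar>) * exp \<bar>z\<bar>" by (intro mult_right_mono) auto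
    also have "\<dots> = 27 * exp (2 * \<bar>z\<bar>)" by (simp flip: exp_add)
    also have "exp (2 * \<bar>z\<bar>) \<le> exp (2 * z) + exp (- 2 * z)" by (cases "z \<ge> 0") auto
    finally show ?thesis by simp
  qed
  then show "AE z in std_normal. norm (\<bar>z\<bar> ^ 3 * exp \<bar>z\<bar>) \<le> norm (27 * (exp (2 * z) + exp (- 2 * z)))"
    by (auto intro!: AE_I2 order_trans[OF _ abs_ge_self])
qed simp

text \<open>The normal law with variance 1/n, written as an image measure so that it is a
  probability for every n; at n = 0 the convention z / 0 = 0 yields the point mass at 0.\<close>

definition scaled_normal :: "nat \<Rightarrow> real measure" where
  "scaled_normal n = distr std_normal borel (\<lambda>z. z / sqrt (real n))"

lemma real_distribution_scaled_normal: "real_distribution (scaled_normal n)"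
proof -
  interpret real_distribution std_normal by (rule real_distribution_std_normal)
  show ?thesis unfolding scaled_normal_def by (rule real_distribution_distr) simp
qed

text \<open>The condition h <= sqrt n gives exp (h |z| / sqrt n) <= exp |z|, so the weighted third
  moment is controlled by a constant independent of h and n.\<close>

lemma scaled_normal_moments:
  assumes n: "n \<ge> 1" and h: "0 \<le> h" "h \<le> sqrt (real n)"
  shows "(\<integral>y. y \<partial>scaled_normal n) = 0" "(\<integral>y. y\<^sup>2 \<partial>scaled_normal n) = 1 / real n"
    "integrable (scaled_normal n) (\<lambda>y. \<bar>y\<bar> ^ 3 * exp (h * \<bar>y\<bar>))"
    "real n * (\<integral>y. \<bar>y\<bar> ^ 3 * exp (h * \<bar>y\<bar>) \<partial>scaled_normal n)
       \<le> (\<integral>z. \<bar>z\<bar> ^ 3 * exp \<bar>z\<bar> \<partial>std_normal) / sqrt (real n)"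
proof -
  let ?s = "sqrt (real n)"
  have s: "?s > 0" using n by simp
  show "(\<integral>y. y \<partial>scaled_normal n) = 0"
    using integral_std_normal_moment_odd[of 0]
    by (simp add: scaled_normal_def integral_distr integral_std_normal)
  show "(\<integral>y. y\<^sup>2 \<partial>scaled_normal n) = 1 / real n"
    using integral_std_normal_moment_even[of 1]
    by (simp add: scaled_normal_def integral_distr integral_std_normal power_divide)
  have le: "\<bar>z / ?s\<bar> ^ 3 * exp (h * \<bar>z / ?s\<bar>) \<le> (1 / ?s ^ 3) * (\<bar>z\<bar> ^ 3 * exp \<bar>z\<bar>)" for z
  proof -
    have "h / ?s * \<bar>z\<bar> \<le> 1 * \<bar>z\<bar>" using h s by (intro mult_right_mono) auto
    then have "exp (h * \<bar>z / ?s\<bar>) \<le> exp \<bar>z\<bar>" using s by simp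
    then have "\<bar>z / ?s\<bar> ^ 3 * exp (h * \<bar>z / ?s\<bar>) \<le> \<bar>z / ?s\<bar> ^ 3 * exp \<bar>z\<bar>" by (intro mult_left_mono) auto
    then show ?thesis using s by (simp add: power_divide)
  qed
  have i: "integrable std_normal (\<lambda>z. \<bar>z / ?s\<bar> ^ 3 * exp (h * \<bar>z / ?s\<bar>))"
    by (rule Bochner_Integration.integrable_bound[OF integrable_mult_right[OF integrable_std_normal_third, of "1 / ?s ^ 3"]])
       (use le in \<open>auto intro!: AE_I2 order_trans[OF _ abs_ge_self] simp del: abs_divide\<close>)
  then show "integrable (scaled_normal n) (\<lambda>y. \<bar>y\<bar> ^ 3 * exp (h * \<bar>y\<bar>))"
    unfolding scaled_normal_def by (subst integrable_distr_eq) auto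
  have "(\<integral>y. \<bar>y\<bar> ^ 3 * exp (h * \<bar>y\<bar>) \<partial>scaled_normal n) = (\<integral>z. \<bar>z / ?s\<bar> ^ 3 * exp (h * \<bar>z / ?s\<bar>) \<partial>std_normal)"
    unfolding scaled_normal_def by (subst integral_distr) auto
  also have "\<dots> \<le> (\<integral>z. (1 / ?s ^ 3) * (\<bar>z\<bar> ^ 3 * exp \<bar>z\<bar>) \<partial>std_normal)"
    by (intro integral_mono i integrable_mult_right integrable_std_normal_third le)
  also have "\<dots> = (1 / ?s ^ 3) * (\<integral>z. \<bar>z\<bar> ^ 3 * exp \<bar>z\<bar> \<partial>std_normal)" by (rule integral_mult_right_zero)
  finally have "real n * (\<integral>y. \<bar>y\<bar> ^ 3 * exp (h * \<bar>y\<bar>) \<partial>scaled_normal n)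
      \<le> real n * ((1 / ?s ^ 3) * (\<integral>z. \<bar>z\<bar> ^ 3 * exp \<bar>z\<bar> \<partial>std_normal))" by (intro mult_left_mono) auto
  also have "real n * ((1 / ?s ^ 3) * I) = I / ?s" for I
  proof -
    have "?s ^ 3 = real n * ?s" by (simp add: eval_nat_numeral)
    then show ?thesis using n by simp
  qed
  finally show "real n * (\<integral>y. \<bar>y\<bar> ^ 3 * exp (h * \<bar>y\<bar>) \<partial>scaled_normal n)
       \<le> (\<integral>z. \<bar>z\<bar> ^ 3 * exp \<bar>z\<bar> \<partial>std_normal) / sqrt (real n)" .
qed

text \<open>Stability of the normal law. It is proved on the product space of n standard normals,
  where \<open>expectation_sum_eq_smear\<close> translates iterated smearing into the law of a sum
  of independent normals.\<close>

lemma smear_scaled_normal_iterate: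
  assumes n: "n \<ge> 1" and f: "bounded_borel f"
  shows "(smear (scaled_normal n) ^^ n) f w = smear std_normal f w"
proof -
  let ?s = "sqrt (real n)"
  have s: "?s > 0" using n by simp
  interpret N: real_distribution std_normal by (rule real_distribution_std_normal)
  let ?I = "{1..n}"
  interpret P: product_prob_space "\<lambda>_. std_normal" ?I ..
  let ?P = "PiM ?I (\<lambda>_. std_normal)"
  note [measurable] = bounded_borel_measurable[OF f]
  have comp: "distr ?P borel (\<lambda>\<omega>. \<omega> i) = std_normal" if "i \<in> ?I" for i
  proof -
    have "distr ?P std_normal (\<lambda>\<omega>. \<omega> i) = std_normal" using that by (rule P.PiM_component)
    then show ?thesis by (simp cong: distr_cong)
  qed
  have ind: "P.P.indep_vars (\<lambda>_. borel) (\<lambda>i \<omega>. \<omega> i) ?I"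
  proof (subst P.P.indep_vars_iff_distr_eq_PiM')
    have "distr ?P (PiM ?I (\<lambda>_. borel)) (\<lambda>x. \<lambda>i\<in>?I. x i) = distr ?P ?P (\<lambda>x. x)"
      by (intro distr_cong sets_PiM_cong) (auto simp: space_PiM)
    also have "\<dots> = ?P" by simp
    also have "\<dots> = PiM ?I (\<lambda>i. distr ?P borel (\<lambda>\<omega>. \<omega> i))"
      by (intro PiM_cong refl comp[symmetric])
    finally show "distr ?P (PiM ?I (\<lambda>_. borel)) (\<lambda>x. \<lambda>i\<in>?I. x i) = PiM ?I (\<lambda>i. distr ?P borel (\<lambda>\<omega>. \<omega> i))" .
  qed (use n in auto)
  define Y :: "nat \<Rightarrow> (nat \<Rightarrow> real) \<Rightarrow> real" where "Y = (\<lambda>i \<omega>. \<omega> i / ?s :: real)"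
  have indY: "P.P.indep_vars (\<lambda>_. borel) Y ?I"
    unfolding Y_def by (rule P.P.indep_vars_compose2[OF ind, where Y = "\<lambda>_ z. z / ?s"]) simp
  have dY: "distr ?P borel (Y i) = scaled_normal n" if i: "i \<in> ?I" for i
  proof -
    have "scaled_normal n = distr (distr ?P borel (\<lambda>\<omega>. \<omega> i)) borel (\<lambda>z. z / ?s)"
      unfolding comp[OF i] scaled_normal_def ..
    also have "\<dots> = distr ?P borel (Y i)"
      using i by (subst distr_distr) (auto simp: Y_def comp_def)
    finally show ?thesis by simp
  qed
  have dist0: "distributed ?P lborel (\<lambda>\<omega>. \<omega> i) std_normal_density" if i: "i \<in> ?I" for i
    using comp[OF i] i by (auto simp: distributed_def std_normal_def cong: distr_cong)
  have dist: "distributed ?P lborel (Y i) (normal_density 0 (1 / ?s))" if i: "i \<in> ?I" for i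
    using P.P.normal_density_affine[OF dist0[OF i], of "1 / ?s" 0] s by (simp add: Y_def)
  have "distributed ?P lborel (\<lambda>\<omega>. \<Sum>i\<in>?I. Y i \<omega>)
      (normal_density (\<Sum>i\<in>?I. 0) (sqrt (\<Sum>i\<in>?I. (1 / ?s)\<^sup>2)))"
    by (rule P.P.sum_indep_normal) (use n indY dist s in auto)
  then have D: "distributed ?P lborel (\<lambda>\<omega>. \<Sum>i\<in>?I. Y i \<omega>) std_normal_density"
    using n by (simp add: power_divide)
  have "(smear (scaled_normal n) ^^ card ?I) f w = P.P.expectation (\<lambda>\<omega>. f (w + (\<Sum>i\<in>?I. Y i \<omega>)))"
    by (rule P.P.expectation_sum_eq_smear[symmetric])
       (use indY dY f real_distribution_scaled_normal in auto)
  also have "\<dots> = (\<integral>z. std_normal_density z * f (w + z) \<partial>lborel)"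
    by (rule distributed_integral[OF D, symmetric]) auto
  also have "\<dots> = smear std_normal f w" by (simp add: smear_def integral_std_normal)
  finally show ?thesis by simp
qed

section \<open>Increments and lower bounds of the normal tail\<close>

lemma Phi_tail: "1 - Phi x = measure std_normal {x<..}"
proof -
  interpret real_distribution std_normal by (rule real_distribution_std_normal)
  have "{x<..} = space std_normal - {..x}" by auto
  then show ?thesis using prob_compl[of "{..x}"] by (simp add: Phi_def std_normal_def)
qed

lemma measure_std_normal_bounds:
  assumes "x \<le> y"
  shows "(\<And>z. x < z \<Longrightarrow> z \<le> y \<Longrightarrow> std_normal_density z \<le> B) \<Longrightarrow> measure std_normal {x<..y} \<le> (y - x) * B"
    and "(\<And>z. x < z \<Longrightarrow> z \<le> y \<Longrightarrow> B \<le> std_normal_density z) \<Longrightarrow> (y - x) * B \<le> measure std_normal {x<..y}"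
proof -
  interpret real_distribution std_normal by (rule real_distribution_std_normal)
  have eq: "measure std_normal {x<..y} = (\<integral>z. std_normal_density z * indicator {x<..y} z \<partial>lborel)"
    using integral_std_normal[of "indicator {x<..y}"] by simp
  have i: "integrable lborel (\<lambda>z. std_normal_density z * indicator {x<..y} z)"
    using integrable_std_normal_iff[of "indicator {x<..y}"] by (simp add: emeasure_eq_measure)
  have c: "integrable lborel (\<lambda>z. B * indicator {x<..y} z)" using assms by simp
  have cv: "(\<integral>z. B * indicator {x<..y} z \<partial>lborel) = (y - x) * B" using assms by simp
  show "measure std_normal {x<..y} \<le> (y - x) * B" if "\<And>z. x < z \<Longrightarrow> z \<le> y \<Longrightarrow> std_normal_density z \<le> B"
    unfolding eq cv[symmetric] by (rule integral_mono[OF i c]) (auto simp: indicator_def that)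
  show "(y - x) * B \<le> measure std_normal {x<..y}" if "\<And>z. x < z \<Longrightarrow> z \<le> y \<Longrightarrow> B \<le> std_normal_density z"
    unfolding eq cv[symmetric] by (rule integral_mono[OF c i]) (auto simp: indicator_def that)
qed

lemma Phi_diff: "x \<le> y \<Longrightarrow> (1 - Phi x) - (1 - Phi y) = measure std_normal {x<..y}"
proof -
  assume xy: "x \<le> y"
  interpret real_distribution std_normal by (rule real_distribution_std_normal)
  have un: "{x<..y} \<union> {y<..} = {x<..}" using xy by auto
  have "prob ({x<..y} \<union> {y<..}) = prob {x<..y} + prob {y<..}"
    by (rule finite_measure_Union) auto
  then show ?thesis unfolding un Phi_tail by simp
qed

text \<open>Within distance d of x the density is at most exp (-h^2/2 + h d): if h > d then z >= h -
  d > 0 and z^2 >= h^2 - 2 h d, and if h <= d the quantity h^2 - 2 h d is not positive at all. The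
  second case contains every x <= 0.\<close>

lemma Phi_tail_increment:
  assumes h: "h = max x 0" and "x - d \<le> u" "u \<le> v" "v \<le> x + d" "0 \<le> d" "v - u \<le> d"
  shows "(1 - Phi u) - (1 - Phi v) \<le> d * exp (- h\<^sup>2 / 2 + h * d)"
proof -
  have "std_normal_density z \<le> exp (- h\<^sup>2 / 2 + h * d)" if "u < z" "z \<le> v" for z
  proof -
    have "h\<^sup>2 - 2 * (h * d) \<le> z\<^sup>2"
    proof (cases "h \<le> d")
      case True
      then have "h * h \<le> h * d" using h by (intro mult_left_mono) auto
      moreover have "0 \<le> h * d" using h \<open>0 \<le> d\<close> by simp
      ultimately have "h\<^sup>2 - 2 * (h * d) \<le> 0" unfolding power2_eq_square by linarith
      then show ?thesis using zero_le_power2[of z] by linarith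
    next
      case False
      then have "(h - d)\<^sup>2 \<le> z\<^sup>2" using that assms by (intro power_mono) (auto simp: max_def split: if_splits)
      moreover have "h\<^sup>2 - 2 * (h * d) \<le> (h - d)\<^sup>2" by (simp add: power2_diff)
      ultimately show ?thesis by linarith
    qed
    then have "exp (- z\<^sup>2 / 2) \<le> exp (- h\<^sup>2 / 2 + h * d)" by simp
    moreover have "1 / sqrt (2 * pi) \<le> 1"
      using pi_ge_two by (simp add: real_le_rsqrt)
    ultimately have "1 / sqrt (2 * pi) * exp (- z\<^sup>2 / 2) \<le> 1 * exp (- h\<^sup>2 / 2 + h * d)"
      by (intro mult_mono) auto
    then show ?thesis by (simp add: std_normal_density_def)
  qed
  from measure_std_normal_bounds(1)[OF assms(3) this]
  have "measure std_normal {u<..v} \<le> (v - u) * exp (- h\<^sup>2 / 2 + h * d)" .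
  also have "\<dots> \<le> d * exp (- h\<^sup>2 / 2 + h * d)" using assms by (intro mult_right_mono) auto
  finally show ?thesis using Phi_diff[OF assms(3)] by simp
qed

text \<open>A lower bound of Mills type from the interval of length 1 / (1 + h) to the right of h.
  There z^2 <= h^2 + 3, which costs at most the factor exp 2, and 10 is a crude bound for sqrt (2
  pi).\<close>

lemma Phi_tail_lower:
  assumes h: "h = max x 0"
  shows "1 - Phi x \<ge> exp (- h\<^sup>2 / 2) / (10 * exp 2 * (1 + h))"
proof -
  interpret real_distribution std_normal by (rule real_distribution_std_normal)
  have h0: "h \<ge> 0" using h by simp
  let ?B = "exp (- h\<^sup>2 / 2) / (10 * exp 2)"
  have "?B \<le> std_normal_density z" if z: "h < z" "z \<le> h + 1 / (1 + h)" for z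
  proof -
    have "z\<^sup>2 \<le> (h + 1 / (1 + h))\<^sup>2" using z h0 by (intro power_mono) auto
    also have "\<dots> = h\<^sup>2 + 2 * (h / (1 + h)) + (1 / (1 + h))\<^sup>2" by (simp add: power2_sum)
    also have "\<dots> \<le> h\<^sup>2 + 2 * 1 + 1\<^sup>2" using h0 by (intro add_mono mult_left_mono power_mono) (auto simp: divide_simps)
    finally have "exp (- h\<^sup>2 / 2 - 2) \<le> exp (- z\<^sup>2 / 2)" by simp
    moreover have "1 / 10 \<le> 1 / sqrt (2 * pi)"
    proof -
      have "sqrt (2 * pi) \<le> sqrt 100" using pi_less_4 by (intro real_sqrt_le_mono) linarith
      also have "sqrt 100 = 10" using real_sqrt_abs[of 10] by simp
      finally show ?thesis using pi_gt_zero by (intro divide_left_mono) auto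
    qed
    ultimately have "1 / 10 * exp (- h\<^sup>2 / 2 - 2) \<le> 1 / sqrt (2 * pi) * exp (- z\<^sup>2 / 2)"
      by (intro mult_mono) auto
    then show ?thesis by (simp add: std_normal_density_def exp_diff)
  qed
  then have "(h + 1 / (1 + h) - h) * ?B \<le> measure std_normal {h<..h + 1 / (1 + h)}"
    using h0 by (intro measure_std_normal_bounds(2)) auto
  also have "\<dots> \<le> measure std_normal {x<..}" using h by (intro finite_measure_mono) auto
  finally show ?thesis by (simp add: Phi_tail mult.commute)
qed

section \<open>Comparison of an independent sum with the normal law\<close>

definition normal_const :: real where
  "normal_const = (\<integral>z. \<bar>z\<bar> ^ 3 * exp \<bar>z\<bar> \<partial>std_normal)"

lemma normal_const_nonneg: "0 \<le> normal_const"
  unfolding normal_const_def by (rule Bochner_Integration.integral_nonneg) auto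

text \<open>Replacement evaluated at w = 0. \<open>B\<close> bounds n times the error of a single
  exchange, in which \<open>A\<close> accounts for the summand and \<open>normal_const\<close> for
  its normal substitute. The same \<open>B\<close> controls how far the exponential moment of the
  sum may exceed exp (h^2/2).\<close>

lemma (in prob_space) smooth_comparison:
  fixes Y :: "nat \<Rightarrow> 'a \<Rightarrow> real"
  assumes n: "n \<ge> 1" and ind: "indep_vars (\<lambda>_. borel) Y {1..n}"
    and dist: "\<And>i. i \<in> {1..n} \<Longrightarrow> distr M borel (Y i) = \<mu>" and R: "real_distribution \<mu>"
    and h: "0 \<le> h" "h \<le> sqrt (real n)"
    and i: "integrable \<mu> (\<lambda>y. \<bar>y\<bar> ^ 3 * exp (h * \<bar>y\<bar>))"
    and A: "real n * (\<bar>\<integral>y. y \<partial>\<mu>\<bar> + \<bar>(\<integral>y. y\<^sup>2 \<partial>\<mu>) - 1 / real n\<bar> + (\<integral>y. \<bar>y\<bar> ^ 3 * exp (h * \<bar>y\<bar>) \<partial>\<mu>)) \<le> A"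
    and f: "bounded_borel f" and L: "L \<ge> 0"
    and f12: "\<And>w. \<bar>f1 w\<bar> \<le> L * indicator {a<..} w" "\<And>w. \<bar>f2 w\<bar> \<le> L * indicator {a<..} w"
    and taylor: "\<And>w y. \<bar>f (w + y) - f w - f1 w * y - f2 w * y\<^sup>2\<bar> \<le> L * \<bar>y\<bar> ^ 3 * indicator {a<..} (w + \<bar>y\<bar>)"
    and B: "B = A + normal_const / sqrt (real n)"
  shows "\<bar>expectation (\<lambda>\<omega>. f (\<Sum>i=1..n. Y i \<omega>)) - (\<integral>z. f z \<partial>std_normal)\<bar>
           \<le> L * B * exp (h\<^sup>2 / 2 + (1 + h) ^ 3 * B - h * a)"
proof -
  interpret R: real_distribution \<mu> by fact
  interpret G: real_distribution "scaled_normal n" by (rule real_distribution_scaled_normal)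
  note G = scaled_normal_moments[OF n h, folded normal_const_def]
  define t1 t2 t3 g3 where "t1 = (\<integral>y. y \<partial>\<mu>)" and "t2 = (\<integral>y. y\<^sup>2 \<partial>\<mu>)"
    and "t3 = (\<integral>y. \<bar>y\<bar> ^ 3 * exp (h * \<bar>y\<bar>) \<partial>\<mu>)"
    and "g3 = (\<integral>y. \<bar>y\<bar> ^ 3 * exp (h * \<bar>y\<bar>) \<partial>scaled_normal n)"
  have nn: "0 \<le> t3" "0 \<le> g3" unfolding t3_def g3_def by (auto intro!: Bochner_Integration.integral_nonneg)
  have A': "real n * (\<bar>t1\<bar> + \<bar>t2 - 1 / real n\<bar> + t3) \<le> A" using A by (simp add: t1_def t2_def t3_def)
  have g3: "real n * g3 \<le> normal_const / sqrt (real n)" using G(4) by (simp add: g3_def)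
  define S where "S = \<bar>t1\<bar> + \<bar>t2 - 1 / real n\<bar> + t3 + g3"
  have S: "real n * S \<le> B" using A' g3 B by (simp add: S_def algebra_simps)
  have S0: "0 \<le> S" using nn by (simp add: S_def)
  have B0: "0 \<le> B" using S S0 n by (meson mult_nonneg_nonneg of_nat_0_le_iff order_trans)
  have Sn: "S \<le> B / real n" using S n by (simp add: le_divide_eq mult.commute)
  define D where "D = L * S * exp (- h * a)"
  have step: "\<bar>smear \<mu> f w - smear (scaled_normal n) f w\<bar> \<le> D * exp (h * w)" for w
  proof -
    have "\<bar>smear \<mu> f w - smear (scaled_normal n) f w\<bar> \<le> L * S * exp (h * (w - a))"
      using smear_one_step[OF R G.real_distribution_axioms h(1) i G(3) f L f12 taylor, of w]
      by (simp add: S_def t1_def t2_def t3_def g3_def G)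
    also have "\<dots> = D * exp (h * w)" by (simp add: D_def algebra_simps flip: exp_add)
    finally show ?thesis .
  qed
  \<comment> \<open>Chosen for its n-th power: h^2 / (2 n) is the exponent of the exact normal
    moment, and the rest absorbs the moment discrepancies, whose sum \<open>S\<close> is at most B /
    n.\<close>
  define m where "m = exp ((h\<^sup>2 / 2 + (1 + h) ^ 3 * B) / real n)"
  have m1: "1 \<le> m" using h B0 by (simp add: m_def)
  \<comment> \<open>These are the coefficients of the discrepancies in the first, second and
    weighted third moment; a common majorant lets them be estimated through their sum
    \<open>S\<close>.\<close>
  have hp: "h \<le> (1 + h) ^ 3" "h\<^sup>2 / 2 \<le> (1 + h) ^ 3" "h ^ 3 \<le> (1 + h) ^ 3"
  proof -
    have "(1 + h) ^ 3 = 1 + 3 * h + 3 * h\<^sup>2 + h ^ 3" by algebra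
    then show "h \<le> (1 + h) ^ 3" "h\<^sup>2 / 2 \<le> (1 + h) ^ 3" "h ^ 3 \<le> (1 + h) ^ 3"
      using h(1) zero_le_power[OF h(1), of 2] zero_le_power[OF h(1), of 3] by linarith+
  qed
  have mb: "exp (h * u1 + h\<^sup>2 / 2 * u2 + h ^ 3 * u3) \<le> m"
    if u: "\<bar>u1\<bar> + \<bar>u2 - 1 / real n\<bar> + u3 \<le> S" "0 \<le> u3" for u1 u2 u3
  proof -
    have "h * u1 + h\<^sup>2 / 2 * u2 + h ^ 3 * u3
        \<le> h * \<bar>u1\<bar> + h\<^sup>2 / 2 * (1 / real n + \<bar>u2 - 1 / real n\<bar>) + h ^ 3 * u3"
      using h by (intro add_mono mult_left_mono) auto
    also have "\<dots> = h\<^sup>2 / 2 / real n + (h * \<bar>u1\<bar> + h\<^sup>2 / 2 * \<bar>u2 - 1 / real n\<bar> + h ^ 3 * u3)"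
      by (simp add: algebra_simps)
    also have "h * \<bar>u1\<bar> + h\<^sup>2 / 2 * \<bar>u2 - 1 / real n\<bar> + h ^ 3 * u3
        \<le> (1 + h) ^ 3 * \<bar>u1\<bar> + (1 + h) ^ 3 * \<bar>u2 - 1 / real n\<bar> + (1 + h) ^ 3 * u3"
      using u hp by (intro add_mono mult_right_mono) auto
    also have "\<dots> = (1 + h) ^ 3 * (\<bar>u1\<bar> + \<bar>u2 - 1 / real n\<bar> + u3)" by (simp add: algebra_simps)
    also have "\<dots> \<le> (1 + h) ^ 3 * (B / real n)" using u(1) Sn h by (intro mult_left_mono) auto
    finally show ?thesis by (simp add: m_def add_divide_distrib)
  qed
  have mm: "(\<integral>y. exp (h * y) \<partial>\<mu>) \<le> m" "(\<integral>y. exp (h * y) \<partial>scaled_normal n) \<le> m"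
  proof -
    show "(\<integral>y. exp (h * y) \<partial>\<mu>) \<le> m"
      using nn by (intro order_trans[OF R.exp_moment_bound(2)[OF h(1) i] mb])
        (auto simp: S_def simp flip: t1_def t2_def t3_def)
    show "(\<integral>y. exp (h * y) \<partial>scaled_normal n) \<le> m"
      using nn by (intro order_trans[OF G.exp_moment_bound(2)[OF h(1) G(3)] mb])
        (auto simp: S_def G(1,2) simp flip: g3_def)
  qed
  have "\<bar>(smear \<mu> ^^ n) f 0 - (smear (scaled_normal n) ^^ n) f 0\<bar> \<le> real n * D * m ^ n * exp (h * 0)"
    by (rule smear_iterate_compare[OF R G.real_distribution_axioms f step
          R.exp_moment_bound(1)[OF h(1) i] G.exp_moment_bound(1)[OF h(1) G(3)] mm m1])
  moreover have "expectation (\<lambda>\<omega>. f (\<Sum>i=1..n. Y i \<omega>)) = (smear \<mu> ^^ n) f 0"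
    using expectation_sum_eq_smear[OF _ ind dist R f, of 0] by simp
  moreover have "(\<integral>z. f z \<partial>std_normal) = (smear (scaled_normal n) ^^ n) f 0"
    using smear_scaled_normal_iterate[OF n f, of 0] by (simp add: smear_def)
  moreover have "m ^ n = exp (h\<^sup>2 / 2 + (1 + h) ^ 3 * B)"
    using n by (simp add: m_def flip: exp_of_nat_mult)
  ultimately have "\<bar>expectation (\<lambda>\<omega>. f (\<Sum>i=1..n. Y i \<omega>)) - (\<integral>z. f z \<partial>std_normal)\<bar>
      \<le> real n * D * exp (h\<^sup>2 / 2 + (1 + h) ^ 3 * B)" by simp
  also have "\<dots> = L * (real n * S) * exp (h\<^sup>2 / 2 + (1 + h) ^ 3 * B - h * a)"
    using exp_add[of "h\<^sup>2 / 2 + (1 + h) ^ 3 * B" "- h * a"] by (simp add: D_def)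
  also have "\<dots> \<le> L * B * exp (h\<^sup>2 / 2 + (1 + h) ^ 3 * B - h * a)"
    using S L by (intro mult_right_mono mult_left_mono) auto
  finally show ?thesis .
qed

text \<open>Two smooth steps enclose the indicator, one rising just after x and one just before it.
  The weight then leaves exp (h^2/2 - h a) with a >= x - d, hence exp (-h^2/2 + h d).
  \<open>K\<close> is obtained ahead of all other data since it must be uniform in n, x and the law
  of the summands.\<close>

lemma tail_comparison:
  obtains K :: real where "K > 0" and
    "\<And>(M :: 'a measure) Y \<mu> n x h d A B. prob_space M \<Longrightarrow> n \<ge> 1 \<Longrightarrow>
      prob_space.indep_vars M (\<lambda>_. borel) Y {1..n} \<Longrightarrow>
      (\<And>i. i \<in> {1..n} \<Longrightarrow> distr M borel (Y i) = \<mu>) \<Longrightarrow> real_distribution \<mu> \<Longrightarrow>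
      h = max x 0 \<Longrightarrow> h \<le> sqrt (real n) \<Longrightarrow> 0 < d \<Longrightarrow> d \<le> 1 \<Longrightarrow>
      integrable \<mu> (\<lambda>y. \<bar>y\<bar> ^ 3 * exp (h * \<bar>y\<bar>)) \<Longrightarrow>
      real n * (\<bar>\<integral>y. y \<partial>\<mu>\<bar> + \<bar>(\<integral>y. y\<^sup>2 \<partial>\<mu>) - 1 / real n\<bar> + (\<integral>y. \<bar>y\<bar> ^ 3 * exp (h * \<bar>y\<bar>) \<partial>\<mu>)) \<le> A \<Longrightarrow>
      B = A + normal_const / sqrt (real n) \<Longrightarrow>
      \<bar>measure M {\<omega> \<in> space M. (\<Sum>i=1..n. Y i \<omega>) > x} - (1 - Phi x)\<bar>
        \<le> exp (- h\<^sup>2 / 2) * (d * exp (h * d) + K / d ^ 3 * B * exp ((1 + h) ^ 3 * B + h * d))"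
proof -
  obtain K :: real where K: "K > 0"
    and step: "\<And>a d::real. 0 < d \<Longrightarrow> d \<le> 1 \<Longrightarrow> \<exists>f f1 f2. f \<in> borel_measurable borel \<and>
       (\<forall>w. 0 \<le> f w \<and> f w \<le> 1) \<and> (\<forall>w\<le>a. f w = 0) \<and> (\<forall>w\<ge>a+d. f w = 1) \<and>
       (\<forall>w. \<bar>f1 w\<bar> \<le> K / d^3 * indicator {a<..} w) \<and> (\<forall>w. \<bar>f2 w\<bar> \<le> K / d^3 * indicator {a<..} w) \<and>
       (\<forall>w y. \<bar>f (w + y) - f w - f1 w * y - f2 w * y\<^sup>2\<bar> \<le> K / d^3 * \<bar>y\<bar>^3 * indicator {a<..} (w + \<bar>y\<bar>))"
    by (rule localized_smooth_step) blast
  interpret N: real_distribution std_normal by (rule real_distribution_std_normal)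
  show thesis
  proof (rule that[OF K])
    fix M :: "'a measure" and Y :: "nat \<Rightarrow> 'a \<Rightarrow> real" and \<mu> and n :: nat and x h d A B :: real
    assume "prob_space M" and n: "n \<ge> 1" and ind: "prob_space.indep_vars M (\<lambda>_. borel) Y {1..n}"
      and dist: "\<And>i. i \<in> {1..n} \<Longrightarrow> distr M borel (Y i) = \<mu>" and R: "real_distribution \<mu>"
      and h: "h = max x 0" "h \<le> sqrt (real n)" and d: "0 < d" "d \<le> 1"
      and i: "integrable \<mu> (\<lambda>y. \<bar>y\<bar> ^ 3 * exp (h * \<bar>y\<bar>))"
      and A: "real n * (\<bar>\<integral>y. y \<partial>\<mu>\<bar> + \<bar>(\<integral>y. y\<^sup>2 \<partial>\<mu>) - 1 / real n\<bar> + (\<integral>y. \<bar>y\<bar> ^ 3 * exp (h * \<bar>y\<bar>) \<partial>\<mu>)) \<le> A"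
      and B: "B = A + normal_const / sqrt (real n)"
    interpret prob_space M by fact
    have h0: "0 \<le> h" using h by simp
    \<comment> \<open>This also holds for x < 0, where both sides vanish; it is what makes the
      exponent collapse to -h^2/2 without a case distinction.\<close>
    have hx: "h * x = h\<^sup>2" using h by (auto simp: max_def power2_eq_square)
    let ?T = "\<lambda>\<omega>. \<Sum>i=1..n. Y i \<omega>"
    have [measurable]: "Y i \<in> borel_measurable M" if "i \<in> {1..n}" for i
      using ind that by (auto simp: indep_vars_def)
    have T[measurable]: "?T \<in> borel_measurable M" by (rule borel_measurable_sum) simp
    have B0: "0 \<le> B"
    proof -
      have "0 \<le> real n * (\<bar>\<integral>y. y \<partial>\<mu>\<bar> + \<bar>(\<integral>y. y\<^sup>2 \<partial>\<mu>) - 1 / real n\<bar> + (\<integral>y. \<bar>y\<bar> ^ 3 * exp (h * \<bar>y\<bar>) \<partial>\<mu>))"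
        by (intro mult_nonneg_nonneg add_nonneg_nonneg Bochner_Integration.integral_nonneg) auto
      also note A
      finally show ?thesis unfolding B using normal_const_nonneg by (intro add_nonneg_nonneg) auto
    qed
    let ?E = "K / d ^ 3 * B * exp ((1 + h) ^ 3 * B + h * d)"
    have sandwich: "measure std_normal {a + d<..} - exp (- h\<^sup>2 / 2) * ?E \<le> prob {\<omega> \<in> space M. ?T \<omega> > a}"
      "prob {\<omega> \<in> space M. ?T \<omega> > a + d} \<le> measure std_normal {a<..} + exp (- h\<^sup>2 / 2) * ?E"
      if a: "x - d \<le> a" for a
    proof -
      obtain f f1 f2 where f: "f \<in> borel_measurable borel"
        "\<And>w. 0 \<le> f w \<and> f w \<le> 1" "\<And>w. w \<le> a \<Longrightarrow> f w = 0" "\<And>w. w \<ge> a + d \<Longrightarrow> f w = 1"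
        "\<And>w. \<bar>f1 w\<bar> \<le> K / d^3 * indicator {a<..} w" "\<And>w. \<bar>f2 w\<bar> \<le> K / d^3 * indicator {a<..} w"
        "\<And>w y. \<bar>f (w + y) - f w - f1 w * y - f2 w * y\<^sup>2\<bar> \<le> K / d^3 * \<bar>y\<bar>^3 * indicator {a<..} (w + \<bar>y\<bar>)"
        using step[OF d, of a] by blast
      note [measurable] = f(1)
      have bb: "bounded_borel f"
        using f(1,2) by (auto simp: bounded_borel_def intro!: exI[of _ 1])
      have lo: "indicator {a + d<..} w \<le> f w" and hi: "f w \<le> indicator {a<..} w" for w
        using f(2,3,4)[of w] by (auto simp: indicator_def not_less)
      have "\<bar>expectation (\<lambda>\<omega>. f (?T \<omega>)) - (\<integral>z. f z \<partial>std_normal)\<bar>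
           \<le> K / d ^ 3 * B * exp (h\<^sup>2 / 2 + (1 + h) ^ 3 * B - h * a)"
        by (rule smooth_comparison[OF n ind dist R h0 h(2) i A bb _ f(5,6,7) B]) (use K d in auto)
      also have "\<dots> \<le> K / d ^ 3 * B * exp (- h\<^sup>2 / 2 + ((1 + h) ^ 3 * B + h * d))"
      proof -
        have "h * (x - d) \<le> h * a" using a h0 by (intro mult_left_mono) auto
        then have "h\<^sup>2 - h * d \<le> h * a" using hx by (simp only: right_diff_distrib)
        then have "h\<^sup>2 / 2 + (1 + h) ^ 3 * B - h * a \<le> - h\<^sup>2 / 2 + ((1 + h) ^ 3 * B + h * d)" by linarith
        then show ?thesis using K d B0 by (intro mult_left_mono) auto
      qed
      also have "\<dots> = exp (- h\<^sup>2 / 2) * ?E"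
        using exp_add[of "- h\<^sup>2 / 2" "(1 + h) ^ 3 * B + h * d"] by simp
      finally have cmp: "\<bar>expectation (\<lambda>\<omega>. f (?T \<omega>)) - (\<integral>z. f z \<partial>std_normal)\<bar> \<le> exp (- h\<^sup>2 / 2) * ?E" .
      have if1: "integrable M (\<lambda>\<omega>. f (?T \<omega>))"
        using f(2) by (intro integrable_const_bound[where B = 1]) auto
      have if2: "integrable std_normal f"
        using f(2) by (intro N.integrable_const_bound[where B = 1]) auto
      have pM: "prob {\<omega> \<in> space M. ?T \<omega> > b} = (\<integral>\<omega>. indicator {b<..} (?T \<omega>) \<partial>M)" for b
      proof -
        have "(\<integral>\<omega>. indicator {b<..} (?T \<omega>) \<partial>M) = (\<integral>\<omega>. indicator {\<omega> \<in> space M. ?T \<omega> > b} \<omega> \<partial>M :: real)"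
          by (intro Bochner_Integration.integral_cong) (auto simp: indicator_def)
        then show ?thesis by simp
      qed
      have iM: "integrable M (\<lambda>\<omega>. indicator {b<..} (?T \<omega>) :: real)" for b
        by (intro integrable_const_bound[where B = 1]) auto
      have iN: "integrable std_normal (indicator {b<..} :: real \<Rightarrow> real)" for b
        by (intro N.integrable_const_bound[where B = 1]) auto
      have pN: "measure std_normal {b<..} = (\<integral>z. indicator {b<..} z \<partial>std_normal)" for b by simp
      have "expectation (\<lambda>\<omega>. f (?T \<omega>)) \<le> prob {\<omega> \<in> space M. ?T \<omega> > a}"
        unfolding pM by (intro integral_mono if1 iM hi)
      moreover have "prob {\<omega> \<in> space M. ?T \<omega> > a + d} \<le> expectation (\<lambda>\<omega>. f (?T \<omega>))"
        unfolding pM by (intro integral_mono if1 iM lo)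
      moreover have "(\<integral>z. f z \<partial>std_normal) \<le> measure std_normal {a<..}"
        unfolding pN by (intro integral_mono if2 iN hi)
      moreover have "measure std_normal {a + d<..} \<le> (\<integral>z. f z \<partial>std_normal)"
        unfolding pN by (intro integral_mono if2 iN lo)
      ultimately show "measure std_normal {a + d<..} - exp (- h\<^sup>2 / 2) * ?E \<le> prob {\<omega> \<in> space M. ?T \<omega> > a}"
        "prob {\<omega> \<in> space M. ?T \<omega> > a + d} \<le> measure std_normal {a<..} + exp (- h\<^sup>2 / 2) * ?E"
        using cmp by linarith+
    qed
    have "(1 - Phi (x - d)) - (1 - Phi x) \<le> d * exp (- h\<^sup>2 / 2 + h * d)"
      "(1 - Phi x) - (1 - Phi (x + d)) \<le> d * exp (- h\<^sup>2 / 2 + h * d)"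
      using d by (intro Phi_tail_increment[OF h(1)]; simp)+
    \<comment> \<open>The step on [x, x + d] bounds the probability from below, the one on
      [x - d, x] from above.\<close>
    with sandwich(1)[of x] sandwich(2)[of "x - d"] d
    have "\<bar>prob {\<omega> \<in> space M. ?T \<omega> > x} - (1 - Phi x)\<bar> \<le> d * exp (- h\<^sup>2 / 2 + h * d) + exp (- h\<^sup>2 / 2) * ?E"
      unfolding Phi_tail by (simp add: abs_le_iff)
    also have "\<dots> = exp (- h\<^sup>2 / 2) * (d * exp (h * d) + ?E)"
      using exp_add[of "- h\<^sup>2 / 2" "h * d"] by (simp add: distrib_left)
    finally show "\<bar>prob {\<omega> \<in> space M. ?T \<omega> > x} - (1 - Phi x)\<bar> \<le> exp (- h\<^sup>2 / 2) * (d * exp (h * d) + ?E)" .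
  qed
qed

subsection \<open>Moderate deviations of independent sums\<close>

context real_distribution
begin

text \<open>Markov's inequality: for |y| > b and k < q the factor |y|^(k-q) is at most b^(k-q). The
  cases k = 0, 1, 2 serve for the probability of truncating, the mean lost and the variance
  lost.\<close>

lemma powr_tail_moment:
  assumes q: "q > 2" "integrable M (\<lambda>y. \<bar>y\<bar> powr q)" and b: "b > 0" and k: "k \<in> {0, 1, 2}"
  shows "integrable M (\<lambda>y. \<bar>y\<bar> ^ k * indicator {y. \<bar>y\<bar> > b} y)"
    "(\<integral>y. \<bar>y\<bar> ^ k * indicator {y. \<bar>y\<bar> > b} y \<partial>M) \<le> b powr (real k - q) * (\<integral>y. \<bar>y\<bar> powr q \<partial>M)"
proof -
  have le: "\<bar>y\<bar> ^ k * indicator {y. \<bar>y\<bar> > b} y \<le> b powr (real k - q) * \<bar>y\<bar> powr q" for y :: real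
  proof (cases "\<bar>y\<bar> > b")
    case True
    then have y: "\<bar>y\<bar> > 0" using b by linarith
    then have "\<bar>y\<bar> ^ k = \<bar>y\<bar> powr (real k - q) * \<bar>y\<bar> powr q"
      by (simp add: powr_realpow flip: powr_add)
    also have "\<dots> \<le> b powr (real k - q) * \<bar>y\<bar> powr q"
      using True b k q(1) by (intro mult_right_mono powr_mono2') auto
    finally show ?thesis using True by simp
  qed simp
  have [measurable]: "Measurable.pred borel (\<lambda>y::real. \<bar>y\<bar> > b)" by measurable
  have i: "integrable M (\<lambda>y. b powr (real k - q) * \<bar>y\<bar> powr q)" using q by simp
  show "integrable M (\<lambda>y. \<bar>y\<bar> ^ k * indicator {y. \<bar>y\<bar> > b} y)"
    by (rule Bochner_Integration.integrable_bound[OF i])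
       (use le in \<open>auto intro!: AE_I2 order_trans[OF _ abs_ge_self] simp: indicator_def\<close>)
  from integral_mono[OF this i le]
  show "(\<integral>y. \<bar>y\<bar> ^ k * indicator {y. \<bar>y\<bar> > b} y \<partial>M) \<le> b powr (real k - q) * (\<integral>y. \<bar>y\<bar> powr q \<partial>M)" by simp
qed

end

text \<open>Large values are set to 0 and the scaling by s is done at once, without recentering, so
  that the truncated sum equals the scaled original one whenever no summand is large.\<close>

definition truncate :: "real \<Rightarrow> real \<Rightarrow> real \<Rightarrow> real" where
  "truncate b s y = (if \<bar>y\<bar> \<le> b then y / s else 0)"

lemma truncate_measurable[measurable]: "truncate b s \<in> borel_measurable borel"
  unfolding truncate_def[abs_def] by measurable

text \<open>Since the mean is 0, the truncated mean is minus the tail mean, and the second moment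
  falls short by the tail second moment. The condition h (b / s) <= 1 keeps the exponential factor
  below e <= 3, so the weighted third moment is at most 3 (b / s) times the second.\<close>

lemma (in real_distribution) truncated_moments:
  assumes q: "q > 2" "integrable M (\<lambda>y. \<bar>y\<bar> powr q)" and W: "W = (\<integral>y. \<bar>y\<bar> powr q \<partial>M)"
    and mean: "integrable M (\<lambda>y. y)" "(\<integral>y. y \<partial>M) = 0"
    and var: "integrable M (\<lambda>y. y\<^sup>2)" "(\<integral>y. y\<^sup>2 \<partial>M) = v" "v > 0"
    and b: "b > 0" and n: "n \<ge> 1" and s: "s = sqrt (v * real n)" and h: "0 \<le> h" "h * (b / s) \<le> 1"
    and \<mu>: "\<mu> = distr M borel (truncate b s)"
  shows "integrable \<mu> (\<lambda>y. \<bar>y\<bar> ^ 3 * exp (h * \<bar>y\<bar>))"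
    and "real n * (\<bar>\<integral>y. y \<partial>\<mu>\<bar> + \<bar>(\<integral>y. y\<^sup>2 \<partial>\<mu>) - 1 / real n\<bar> + (\<integral>y. \<bar>y\<bar> ^ 3 * exp (h * \<bar>y\<bar>) \<partial>\<mu>))
      \<le> real n / s * (b powr (1 - q) * W) + b powr (2 - q) * W / v + 3 * (b / s)"
proof -
  let ?I = "\<lambda>y::real. indicator {y. \<bar>y\<bar> > b} y :: real"
  have s0: "s > 0" using s n var by simp
  have s2: "s\<^sup>2 = v * real n" using s n var by simp
  have [measurable]: "Measurable.pred borel (\<lambda>y::real. \<bar>y\<bar> > b)" by measurable
  note t1 = powr_tail_moment[OF q b, of 1, simplified] and t2 = powr_tail_moment[OF q b, of 2, simplified]
  have iy: "integrable M (\<lambda>y. y * ?I y)"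
    by (rule Bochner_Integration.integrable_bound[OF mean(1)]) (auto simp: indicator_def)
  have T1: "truncate b s y = (y - y * ?I y) / s" for y by (auto simp: truncate_def)
  have T2: "(truncate b s y)\<^sup>2 = (y\<^sup>2 - y\<^sup>2 * ?I y) / s\<^sup>2" for y by (auto simp: truncate_def power_divide)
  have "(\<integral>y. y \<partial>\<mu>) = (\<integral>y. truncate b s y \<partial>M)" unfolding \<mu> by (subst integral_distr) auto
  also have "\<dots> = - (\<integral>y. y * ?I y \<partial>M) / s" unfolding T1 using mean iy by simp
  finally have "\<bar>\<integral>y. y \<partial>\<mu>\<bar> = \<bar>\<integral>y. y * ?I y \<partial>M\<bar> / s" using s0 by simp
  also have "\<dots> \<le> (\<integral>y. \<bar>y * ?I y\<bar> \<partial>M) / s" using s0 by (intro divide_right_mono integral_abs_bound) auto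
  also have "\<dots> \<le> (b powr (1 - q) * W) / s" using t1 s0 W by (intro divide_right_mono) (auto simp: abs_mult)
  finally have 1: "real n * \<bar>\<integral>y. y \<partial>\<mu>\<bar> \<le> real n / s * (b powr (1 - q) * W)"
    by (auto simp: mult_left_mono dest: mult_left_mono[where c = "real n"])
  have i2: "integrable M (\<lambda>y. (truncate b s y)\<^sup>2)" unfolding T2 using var t2 by simp
  have e2: "(\<integral>y. y\<^sup>2 \<partial>\<mu>) = (\<integral>y. (truncate b s y)\<^sup>2 \<partial>M)" unfolding \<mu> by (subst integral_distr) auto
  also have e2': "\<dots> = (v - (\<integral>y. y\<^sup>2 * ?I y \<partial>M)) / s\<^sup>2" unfolding T2 using var t2 by simp
  finally have "(\<integral>y. y\<^sup>2 \<partial>\<mu>) - 1 / real n = - ((\<integral>y. y\<^sup>2 * ?I y \<partial>M) / (v * real n))"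
    using n var by (simp add: s2 diff_divide_distrib)
  moreover have nn: "0 \<le> (\<integral>y. y\<^sup>2 * ?I y \<partial>M)" by (rule Bochner_Integration.integral_nonneg) auto
  ultimately have "\<bar>(\<integral>y. y\<^sup>2 \<partial>\<mu>) - 1 / real n\<bar> = (\<integral>y. y\<^sup>2 * ?I y \<partial>M) / (v * real n)"
    using n var by simp
  then have "real n * \<bar>(\<integral>y. y\<^sup>2 \<partial>\<mu>) - 1 / real n\<bar> = (\<integral>y. y\<^sup>2 * ?I y \<partial>M) / v"
    using n var by simp
  also have "\<dots> \<le> b powr (2 - q) * W / v" using t2 var W by (intro divide_right_mono) auto
  finally have 2: "real n * \<bar>(\<integral>y. y\<^sup>2 \<partial>\<mu>) - 1 / real n\<bar> \<le> b powr (2 - q) * W / v" .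
  have le: "\<bar>truncate b s y\<bar> ^ 3 * exp (h * \<bar>truncate b s y\<bar>) \<le> (3 * (b / s)) * (truncate b s y)\<^sup>2" for y
  proof -
    have t: "\<bar>truncate b s y\<bar> \<le> b / s" using s0 b by (auto simp: truncate_def divide_right_mono)
    then have "h * \<bar>truncate b s y\<bar> \<le> h * (b / s)" using h by (intro mult_left_mono) auto
    then have "exp (h * \<bar>truncate b s y\<bar>) \<le> exp 1" using h by simp
    also have "\<dots> \<le> 3" by (rule exp_le)
    finally have e: "exp (h * \<bar>truncate b s y\<bar>) \<le> 3" .
    have "\<bar>truncate b s y\<bar> ^ 3 = \<bar>truncate b s y\<bar> * (truncate b s y)\<^sup>2" by (simp add: eval_nat_numeral)
    also have "\<dots> \<le> (b / s) * (truncate b s y)\<^sup>2" using t by (intro mult_right_mono) auto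
    finally have "\<bar>truncate b s y\<bar> ^ 3 * exp (h * \<bar>truncate b s y\<bar>) \<le> ((b / s) * (truncate b s y)\<^sup>2) * 3"
      using e b s0 by (intro mult_mono) auto
    then show ?thesis by (simp add: mult_ac)
  qed
  have i3: "integrable M (\<lambda>y. \<bar>truncate b s y\<bar> ^ 3 * exp (h * \<bar>truncate b s y\<bar>))"
    by (rule Bochner_Integration.integrable_bound[OF integrable_mult_right[OF i2, of "3 * (b / s)"]])
       (use le s0 b in \<open>auto intro!: AE_I2 order_trans[OF _ abs_ge_self]\<close>)
  then show "integrable \<mu> (\<lambda>y. \<bar>y\<bar> ^ 3 * exp (h * \<bar>y\<bar>))" unfolding \<mu> by (subst integrable_distr_eq) auto
  have "(\<integral>y. \<bar>y\<bar> ^ 3 * exp (h * \<bar>y\<bar>) \<partial>\<mu>) = (\<integral>y. \<bar>truncate b s y\<bar> ^ 3 * exp (h * \<bar>truncate b s y\<bar>) \<partial>M)"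
    unfolding \<mu> by (subst integral_distr) auto
  also have "\<dots> \<le> (\<integral>y. (3 * (b / s)) * (truncate b s y)\<^sup>2 \<partial>M)"
    by (intro integral_mono i3 integrable_mult_right i2 le)
  also have "\<dots> = (3 * (b / s)) * ((v - (\<integral>y. y\<^sup>2 * ?I y \<partial>M)) / s\<^sup>2)" using e2' by simp
  also have "\<dots> \<le> (3 * (b / s)) * (v / s\<^sup>2)"
    using nn b s0 by (intro mult_left_mono divide_right_mono) auto
  also have "\<dots> = (3 * (b / s)) / real n" using var n by (simp add: s2)
  finally have "real n * (\<integral>y. \<bar>y\<bar> ^ 3 * exp (h * \<bar>y\<bar>) \<partial>\<mu>) \<le> real n * ((3 * (b / s)) / real n)"
    by (rule mult_left_mono) simp
  also have "\<dots> = 3 * (b / s)" using n by simp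
  finally have 3: "real n * (\<integral>y. \<bar>y\<bar> ^ 3 * exp (h * \<bar>y\<bar>) \<partial>\<mu>) \<le> 3 * (b / s)" .
  show "real n * (\<bar>\<integral>y. y \<partial>\<mu>\<bar> + \<bar>(\<integral>y. y\<^sup>2 \<partial>\<mu>) - 1 / real n\<bar> + (\<integral>y. \<bar>y\<bar> ^ 3 * exp (h * \<bar>y\<bar>) \<partial>\<mu>))
      \<le> real n / s * (b powr (1 - q) * W) + b powr (2 - q) * W / v + 3 * (b / s)"
    using 1 2 3 by (simp only: distrib_left)
qed

text \<open>The two events can differ only where some summand exceeds b, and a union bound
  suffices.\<close>

lemma (in prob_space) truncation_error:
  fixes X :: "nat \<Rightarrow> 'a \<Rightarrow> real"
  assumes meas: "\<And>i. i \<in> {1..n} \<Longrightarrow> X i \<in> borel_measurable M"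
    and dist: "\<And>i. i \<in> {1..n} \<Longrightarrow> distr M borel (X i) = \<rho>" and s: "s > 0"
    and tail: "measure \<rho> {y. \<bar>y\<bar> > b} \<le> p"
  shows "\<bar>prob {\<omega> \<in> space M. (\<Sum>i=1..n. X i \<omega>) > x * s}
      - prob {\<omega> \<in> space M. (\<Sum>i=1..n. truncate b s (X i \<omega>)) > x}\<bar> \<le> real n * p"
proof -
  note [measurable] = meas
  let ?A = "{\<omega> \<in> space M. (\<Sum>i=1..n. X i \<omega>) > x * s}"
    and ?B = "{\<omega> \<in> space M. (\<Sum>i=1..n. truncate b s (X i \<omega>)) > x}"
  let ?U = "\<Union>i\<in>{1..n}. {\<omega> \<in> space M. \<bar>X i \<omega>\<bar> > b}"
  have "(\<lambda>\<omega>. \<Sum>i=1..n. X i \<omega>) \<in> borel_measurable M" by (rule borel_measurable_sum) simp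
  then have A: "?A \<in> events" by measurable
  have "(\<lambda>\<omega>. \<Sum>i=1..n. truncate b s (X i \<omega>)) \<in> borel_measurable M" by (rule borel_measurable_sum) simp
  then have B: "?B \<in> events" by measurable
  have Ui: "{\<omega> \<in> space M. \<bar>X i \<omega>\<bar> > b} \<in> events" if "i \<in> {1..n}" for i using meas[OF that] by measurable
  then have U: "?U \<in> events" by auto
  have same: "\<omega> \<in> ?A \<longleftrightarrow> \<omega> \<in> ?B" if "\<omega> \<in> space M" "\<omega> \<notin> ?U" for \<omega>
  proof -
    have "(\<Sum>i=1..n. truncate b s (X i \<omega>)) = (\<Sum>i=1..n. X i \<omega> / s)"
      using that by (intro sum.cong) (auto simp: truncate_def not_less)
    also have "\<dots> = (\<Sum>i=1..n. X i \<omega>) / s" by (simp add: sum_divide_distrib)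
    finally show ?thesis using that s by (simp add: less_divide_eq)
  qed
  have "prob ?A \<le> prob (?B \<union> ?U)" "prob ?B \<le> prob (?A \<union> ?U)"
    using same A B U by (intro finite_measure_mono; blast)+
  moreover have "prob (?B \<union> ?U) \<le> prob ?B + prob ?U" "prob (?A \<union> ?U) \<le> prob ?A + prob ?U"
    using A B U by (auto intro!: measure_Un_le)
  moreover have "prob ?U \<le> real n * p"
  proof -
    have "prob ?U \<le> (\<Sum>i\<in>{1..n}. prob {\<omega> \<in> space M. \<bar>X i \<omega>\<bar> > b})"
      using Ui by (intro finite_measure_subadditive_finite) auto
    also have "\<dots> \<le> (\<Sum>i\<in>{1..n}. p)"
    proof (rule sum_mono)
      fix i assume i: "i \<in> {1..n}"
      have "{y::real. \<bar>y\<bar> > b} \<in> sets borel" by measurable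
      then have "measure \<rho> {y. \<bar>y\<bar> > b} = prob {\<omega> \<in> space M. \<bar>X i \<omega>\<bar> > b}"
        using i meas[OF i] unfolding dist[OF i, symmetric]
        by (subst measure_distr) (auto intro!: arg_cong[where f = prob])
      then show "prob {\<omega> \<in> space M. \<bar>X i \<omega>\<bar> > b} \<le> p" using tail by simp
    qed
    finally show ?thesis by simp
  qed
  ultimately show ?thesis by linarith
qed


text \<open>The relative error is the absolute one divided by the lower bound for the tail, that is,
  multiplied by a constant times (1 + h) exp (h^2/2). Everything is majorised by an explicit
  \<open>rate\<close> that depends on x only through the largest admissible h.\<close>

lemma (in prob_space) iid_moderate_deviation:
  fixes X :: "nat \<Rightarrow> 'a \<Rightarrow> real" and x :: "nat \<Rightarrow> real"
  assumes meas: "\<And>i. i \<ge> 1 \<Longrightarrow> X i \<in> borel_measurable M"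
    and ind: "\<And>n. n \<ge> 1 \<Longrightarrow> indep_vars (\<lambda>_. borel) X {1..n}"
    and dist: "\<And>i. i \<ge> 1 \<Longrightarrow> distr M borel (X i) = distr M borel (X 1)"
    and mean: "expectation (X 1) = 0"
    and var: "integrable M (\<lambda>\<omega>. (X 1 \<omega>)\<^sup>2)" "expectation (\<lambda>\<omega>. (X 1 \<omega>)\<^sup>2) = v" "v > 0"
    and q: "q > 2" "integrable M (\<lambda>\<omega>. \<bar>X 1 \<omega>\<bar> powr q)"
    and bound: "eventually (\<lambda>n. (x n)\<^sup>2 \<le> (q - 2) / 2 * ln (real n)) sequentially"
  shows "(\<lambda>n. prob {\<omega> \<in> space M. (\<Sum>i=1..n. X i \<omega>) > x n * sqrt (v * real n)} / (1 - Phi (x n)))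
    \<longlonglongrightarrow> 1"
proof -
  define \<rho> where "\<rho> = distr M borel (X 1)"
  have [measurable]: "X (Suc 0) \<in> borel_measurable M" using meas by simp
  interpret R: real_distribution \<rho> unfolding \<rho>_def by (rule real_distribution_distr) simp
  have dist\<rho>: "distr M borel (X i) = \<rho>" if "i \<ge> 1" for i unfolding \<rho>_def by (rule dist[OF that])
  have \<rho>mean: "integrable \<rho> (\<lambda>y. y)" "(\<integral>y. y \<partial>\<rho>) = 0"
    using mean square_integrable_imp_integrable[OF _ var(1)] unfolding \<rho>_def
    by (simp_all add: integrable_distr_eq integral_distr)
  have \<rho>var: "integrable \<rho> (\<lambda>y. y\<^sup>2)" "(\<integral>y. y\<^sup>2 \<partial>\<rho>) = v"
    using var unfolding \<rho>_def by (simp_all add: integrable_distr_eq integral_distr)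
  have \<rho>q: "integrable \<rho> (\<lambda>y. \<bar>y\<bar> powr q)"
    using q unfolding \<rho>_def by (simp add: integrable_distr_eq)
  define W where "W = (\<integral>y. \<bar>y\<bar> powr q \<partial>\<rho>)"
  have W: "0 \<le> W" unfolding W_def by (rule Bochner_Integration.integral_nonneg) auto
  \<comment> \<open>The truncation level is n^(1/2-\<epsilon>). The value of \<epsilon> makes
    \<epsilon> q equal to (q - 2) / 8: small enough that the lost mean, the lost variance and b / s
    are all O(n^-\<epsilon>), and that truncation stays negligible against the tail.\<close>
  define \<kappa> \<epsilon> where "\<kappa> = (q - 2) / 2" and "\<epsilon> = (q - 2) / (8 * q)"
  have \<kappa>: "\<kappa> > 0" using q by (simp add: \<kappa>_def)
  have \<epsilon>: "\<epsilon> > 0" "\<epsilon> \<le> 1 / 8" "\<epsilon> * q = (q - 2) / 8" "\<epsilon> \<le> (q - 2) / 16"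
  proof -
    show "\<epsilon> > 0" "\<epsilon> \<le> 1 / 8" "\<epsilon> * q = (q - 2) / 8" using q by (auto simp: \<epsilon>_def field_simps)
    show "\<epsilon> \<le> (q - 2) / 16" unfolding \<epsilon>_def using q by (intro divide_left_mono) auto
  qed
  define C where "C = W / sqrt v + W / v + 3 / sqrt v + normal_const + 1"
  have C: "C > 0" unfolding C_def using W var normal_const_nonneg by (intro add_nonneg_pos add_nonneg_nonneg) auto
  obtain K :: real where K: "K > 0" and cmp:
    "\<And>(M :: 'a measure) Y \<mu> n x h d A B. prob_space M \<Longrightarrow> n \<ge> 1 \<Longrightarrow>
      prob_space.indep_vars M (\<lambda>_. borel) Y {1..n} \<Longrightarrow>
      (\<And>i. i \<in> {1..n} \<Longrightarrow> distr M borel (Y i) = \<mu>) \<Longrightarrow> real_distribution \<mu> \<Longrightarrow>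
      h = max x 0 \<Longrightarrow> h \<le> sqrt (real n) \<Longrightarrow> 0 < d \<Longrightarrow> d \<le> 1 \<Longrightarrow>
      integrable \<mu> (\<lambda>y. \<bar>y\<bar> ^ 3 * exp (h * \<bar>y\<bar>)) \<Longrightarrow>
      real n * (\<bar>\<integral>y. y \<partial>\<mu>\<bar> + \<bar>(\<integral>y. y\<^sup>2 \<partial>\<mu>) - 1 / real n\<bar> + (\<integral>y. \<bar>y\<bar> ^ 3 * exp (h * \<bar>y\<bar>) \<partial>\<mu>)) \<le> A \<Longrightarrow>
      B = A + normal_const / sqrt (real n) \<Longrightarrow>
      \<bar>measure M {\<omega> \<in> space M. (\<Sum>i=1..n. Y i \<omega>) > x} - (1 - Phi x)\<bar>
        \<le> exp (- h\<^sup>2 / 2) * (d * exp (h * d) + K / d ^ 3 * B * exp ((1 + h) ^ 3 * B + h * d))"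
    by (rule tail_comparison[where 'a = 'a]) blast
  \<comment> \<open>\<open>H\<close> is the largest h that the growth condition on x
    permits.\<close>
  define H d where "H = (\<lambda>n::nat. sqrt (\<kappa> * ln (real n)))" and "d = (\<lambda>n::nat. 1 / ln (real n))"
  define E where "E = (\<lambda>n::nat. C * real n powr (- \<epsilon>))"
  \<comment> \<open>The summands stem from truncation, from smoothing the indicator and from the
    replacement, in this order.\<close>
  define rate where "rate = (\<lambda>n. 10 * exp 2 * ((1 + H n) * (W * real n powr (- ((q - 2) / 8)))
      + (1 + H n) * d n * exp (H n * d n)
      + (1 + H n) * (K / d n ^ 3 * E n * exp ((1 + H n) ^ 3 * E n + H n * d n))))"
  define P where "P = (\<lambda>n. prob {\<omega> \<in> space M. (\<Sum>i=1..n. X i \<omega>) > x n * sqrt (v * real n)})"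
  \<comment> \<open>\<open>e1\<close> gives d <= 1, \<open>e2\<close> admits h in the normal moment
    bounds, and \<open>e3\<close> is the condition h (b / s) <= 1 of the truncated moments.\<close>
  have e1: "eventually (\<lambda>n::nat. 1 \<le> ln (real n)) sequentially" by real_asymp
  have e2: "eventually (\<lambda>n::nat. H n \<le> sqrt (real n)) sequentially" unfolding H_def using \<kappa> by real_asymp
  have "(\<lambda>n::nat. H n * (real n powr (- \<epsilon>) / sqrt v)) \<longlonglongrightarrow> 0"
    unfolding H_def using \<kappa> \<epsilon>(1) var(3) by real_asymp
  then have e3: "eventually (\<lambda>n::nat. H n * (real n powr (- \<epsilon>) / sqrt v) < 1) sequentially"
    by (rule order_tendstoD) simp
  have le_rate: "eventually (\<lambda>n. \<bar>P n / (1 - Phi (x n)) - 1\<bar> \<le> rate n) sequentially"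
    using e1 e2 e3 bound eventually_ge_at_top[of 1]
  proof eventually_elim
    case (elim n)
    have n: "real n \<ge> 1" "real n > 0" using elim(5) by auto
    define h where "h = max (x n) 0"
    define b s where "b = real n powr (1 / 2 - \<epsilon>)" and "s = sqrt (v * real n)"
    have b0: "b > 0" using n by (simp add: b_def)
    have s0: "s > 0" using n var by (simp add: s_def)
    have h0: "0 \<le> h" by (simp add: h_def)
    have h2: "h\<^sup>2 \<le> \<kappa> * ln (real n)" using elim(1,4) \<kappa> by (auto simp: h_def \<kappa>_def max_def)
    have hH: "h \<le> H n" unfolding H_def using h2 by (rule real_le_rsqrt)
    have H0: "0 \<le> H n" using h0 hH by linarith
    have d: "0 < d n" "d n \<le> 1" using elim(1) by (auto simp: d_def)
    have powr_half: "sqrt (real n) = real n powr (1 / 2)" using n by (simp add: powr_half_sqrt)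
    have bs: "b / s = real n powr (- \<epsilon>) / sqrt v"
    proof -
      have "b = sqrt (real n) * real n powr (- \<epsilon>)"
        unfolding b_def powr_half by (simp flip: powr_add)
      then show ?thesis using n by (simp add: s_def real_sqrt_mult)
    qed
    have hbs: "h * (b / s) \<le> 1"
    proof -
      have "h * (b / s) \<le> H n * (b / s)" using hH b0 s0 by (intro mult_right_mono) auto
      then show ?thesis using elim(3) bs by simp
    qed
    define \<mu> where "\<mu> = distr \<rho> borel (truncate b s)"
    have R\<mu>: "real_distribution \<mu>" unfolding \<mu>_def by (rule R.real_distribution_distr) simp
    note mom = R.truncated_moments[OF q(1) \<rho>q W_def \<rho>mean \<rho>var var(3) b0 elim(5) s_def h0 hbs \<mu>_def]
    define A where "A = real n / s * (b powr (1 - q) * W) + b powr (2 - q) * W / v + 3 * (b / s)"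
    define B where "B = A + normal_const / sqrt (real n)"
    have pw: "real n powr r \<le> real n powr (- \<epsilon>)" if "r \<le> - \<epsilon>" for r
      using n that by (intro powr_mono) auto
    have B: "B \<le> E n"
    proof -
      have "real n / s * b powr (1 - q) = real n powr (1 / 2 + (1 / 2 - \<epsilon>) * (1 - q)) / sqrt v"
      proof -
        have "real n / s = sqrt (real n) / sqrt v"
          using n var by (simp add: s_def real_sqrt_mult real_div_sqrt divide_divide_eq_left' field_simps)
        then show ?thesis by (simp add: b_def powr_powr powr_half powr_add)
      qed
      also have "\<dots> \<le> real n powr (- \<epsilon>) / sqrt v"
      proof -
        have "1 / 2 + (1 / 2 - \<epsilon>) * (1 - q) = - ((q - 2) / 2) + \<epsilon> * q - \<epsilon>" by (simp add: field_simps)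
        also have "\<dots> \<le> - \<epsilon>" unfolding \<epsilon>(3) using q by simp
        finally have "1 / 2 + (1 / 2 - \<epsilon>) * (1 - q) \<le> - \<epsilon>" .
        from pw[OF this] show ?thesis using var by (intro divide_right_mono) auto
      qed
      finally have "real n / s * b powr (1 - q) * W \<le> real n powr (- \<epsilon>) / sqrt v * W"
        using W by (rule mult_right_mono)
      then have 1: "real n / s * (b powr (1 - q) * W) \<le> W / sqrt v * real n powr (- \<epsilon>)"
        by (simp add: mult_ac)
      have "(1 / 2 - \<epsilon>) * (2 - q) \<le> - \<epsilon>"
      proof -
        have "(1 / 2 - \<epsilon>) * (2 - q) = - ((q - 2) * (1 / 2 - \<epsilon>))" by (simp add: field_simps)
        also have "\<dots> \<le> - ((q - 2) * (3 / 8))"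
          unfolding neg_le_iff_le using \<epsilon>(2) q(1) by (intro mult_left_mono) auto
        also have "\<dots> \<le> - \<epsilon>" using \<epsilon>(4) q(1) by (simp add: field_simps)
        finally show ?thesis .
      qed
      from pw[OF this] have "b powr (2 - q) * W / v \<le> real n powr (- \<epsilon>) * W / v"
        using W var by (intro divide_right_mono mult_right_mono) (auto simp: b_def powr_powr)
      then have 2: "b powr (2 - q) * W / v \<le> W / v * real n powr (- \<epsilon>)" by (simp add: mult_ac)
      have "1 / sqrt (real n) = real n powr (- (1 / 2))" using n by (simp add: powr_half powr_minus_divide)
      also have "\<dots> \<le> real n powr (- \<epsilon>)" using \<epsilon> by (intro pw) auto
      finally have "normal_const * (1 / sqrt (real n)) \<le> normal_const * real n powr (- \<epsilon>)"
        using normal_const_nonneg by (rule mult_left_mono)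
      then have 3: "normal_const / sqrt (real n) \<le> normal_const * real n powr (- \<epsilon>)" by simp
      have "B \<le> W / sqrt v * real n powr (- \<epsilon>) + W / v * real n powr (- \<epsilon>)
          + 3 / sqrt v * real n powr (- \<epsilon>) + normal_const * real n powr (- \<epsilon>)"
        unfolding B_def A_def using 1 2 3 by (simp add: bs)
      also have "\<dots> \<le> E n" unfolding E_def C_def by (simp add: algebra_simps)
      finally show ?thesis .
    qed
    define Y where "Y = (\<lambda>i \<omega>. truncate b s (X i \<omega>))"
    have indY: "indep_vars (\<lambda>_. borel) Y {1..n}"
      unfolding Y_def using ind[OF elim(5)] by (rule indep_vars_compose2) simp
    have distY: "distr M borel (Y i) = \<mu>" if "i \<in> {1..n}" for i
    proof -
      have "\<mu> = distr (distr M borel (X i)) borel (truncate b s)"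
        using that dist\<rho>[of i] by (simp add: \<mu>_def)
      also have "\<dots> = distr M borel (Y i)"
        using that meas by (subst distr_distr) (auto simp: Y_def comp_def)
      finally show ?thesis by simp
    qed
    have "\<bar>prob {\<omega> \<in> space M. (\<Sum>i=1..n. Y i \<omega>) > x n} - (1 - Phi (x n))\<bar>
        \<le> exp (- h\<^sup>2 / 2) * (d n * exp (h * d n) + K / d n ^ 3 * B * exp ((1 + h) ^ 3 * B + h * d n))"
      by (rule cmp[OF prob_space_axioms elim(5) indY distY R\<mu> h_def _ d mom(1) mom(2)[folded A_def] B_def])
         (use hH elim(2) in auto)
    moreover have "\<bar>P n - prob {\<omega> \<in> space M. (\<Sum>i=1..n. Y i \<omega>) > x n}\<bar> \<le> real n * (b powr (- q) * W)"
      unfolding P_def Y_def s_def[symmetric]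
    proof (rule truncation_error[where \<rho> = \<rho>])
      have "{y::real. \<bar>y\<bar> > b} \<in> sets borel" by measurable
      then show "measure \<rho> {y. \<bar>y\<bar> > b} \<le> b powr (- q) * W"
        using R.powr_tail_moment(2)[OF q(1) \<rho>q b0, of 0] by (simp add: W_def)
    qed (use meas dist\<rho> s0 in auto)
    ultimately have err: "\<bar>P n - (1 - Phi (x n))\<bar> \<le> real n * (b powr (- q) * W)
        + exp (- h\<^sup>2 / 2) * (d n * exp (h * d n) + K / d n ^ 3 * B * exp ((1 + h) ^ 3 * B + h * d n))"
      by linarith
    define Q where "Q = 1 - Phi (x n)"
    define L where "L = exp (- h\<^sup>2 / 2) / (10 * exp 2 * (1 + h))"
    have L: "0 < L" "L \<le> Q"
      using Phi_tail_lower[OF h_def] h0 by (auto simp: L_def Q_def)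
    have Linv: "1 / L = 10 * exp 2 * (1 + h) * exp (h\<^sup>2 / 2)"
      by (simp add: L_def exp_minus field_simps)
    \<comment> \<open>The growth condition on x enters here: exp (h^2/2) <= n^((q-2)/4), while n
      b^-q = n^(-3(q-2)/8), which leaves n^(-(q-2)/8).\<close>
    have small: "exp (h\<^sup>2 / 2) * (real n * (b powr (- q) * W)) \<le> W * real n powr (- ((q - 2) / 8))"
    proof -
      have "exp (h\<^sup>2 / 2) \<le> exp (\<kappa> / 2 * ln (real n))" using h2 by simp
      also have "\<dots> = real n powr (\<kappa> / 2)" using n by (simp add: powr_def)
      finally have "exp (h\<^sup>2 / 2) * (real n * (b powr (- q) * W))
          \<le> real n powr (\<kappa> / 2) * (real n * (b powr (- q) * W))"
        using W n by (intro mult_right_mono) auto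
      also have "\<dots> = W * (real n powr (\<kappa> / 2) * (real n powr 1 * real n powr ((1 / 2 - \<epsilon>) * (- q))))"
        using n by (simp add: b_def powr_powr)
      also have "\<dots> = W * real n powr (\<kappa> / 2 + (1 + (1 / 2 - \<epsilon>) * (- q)))"
        by (simp only: powr_add)
      also have "\<kappa> / 2 + (1 + (1 / 2 - \<epsilon>) * (- q)) = - ((q - 2) / 8)"
      proof -
        have "(1 / 2 - \<epsilon>) * (- q) = \<epsilon> * q - q / 2" by (simp add: left_diff_distrib)
        then show ?thesis unfolding \<kappa>_def \<epsilon>(3) by (simp add: field_simps)
      qed
      finally show ?thesis .
    qed
    have "\<bar>P n / Q - 1\<bar> = \<bar>P n - Q\<bar> / Q" using L by (simp add: field_simps abs_divide)
    also have "\<dots> \<le> \<bar>P n - Q\<bar> / L" using L by (intro divide_left_mono) auto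
    also have "\<dots> = \<bar>P n - Q\<bar> * (1 / L)" by simp
    also have "\<dots> \<le> (real n * (b powr (- q) * W)
        + exp (- h\<^sup>2 / 2) * (d n * exp (h * d n) + K / d n ^ 3 * B * exp ((1 + h) ^ 3 * B + h * d n))) * (1 / L)"
      using err L by (intro mult_right_mono) (auto simp: Q_def)
    also have "\<dots> = 10 * exp 2 * ((1 + h) * (exp (h\<^sup>2 / 2) * (real n * (b powr (- q) * W)))
        + (exp (h\<^sup>2 / 2) * exp (- h\<^sup>2 / 2)) * ((1 + h) * d n * exp (h * d n)
        + (1 + h) * (K / d n ^ 3 * B * exp ((1 + h) ^ 3 * B + h * d n))))"
      unfolding Linv by (simp only: algebra_simps)
    also have "exp (h\<^sup>2 / 2) * exp (- h\<^sup>2 / 2) = 1" by (simp flip: exp_add)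
    also have "10 * exp 2 * ((1 + h) * (exp (h\<^sup>2 / 2) * (real n * (b powr (- q) * W)))
        + 1 * ((1 + h) * d n * exp (h * d n)
        + (1 + h) * (K / d n ^ 3 * B * exp ((1 + h) ^ 3 * B + h * d n)))) \<le> rate n"
    proof -
      have E0: "0 \<le> E n" using C by (simp add: E_def)
      have "(1 + h) * (exp (h\<^sup>2 / 2) * (real n * (b powr (- q) * W)))
          \<le> (1 + H n) * (W * real n powr (- ((q - 2) / 8)))"
        by (rule mult_mono[OF _ small]) (use hH h0 H0 W n in auto)
      moreover have hd: "h * d n \<le> H n * d n" using hH d by (intro mult_right_mono) auto
      then have "(1 + h) * d n * exp (h * d n) \<le> (1 + H n) * d n * exp (H n * d n)"
        using hH h0 H0 d by (intro mult_mono) auto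
      moreover have "(1 + h) * (K / d n ^ 3 * B * exp ((1 + h) ^ 3 * B + h * d n))
          \<le> (1 + H n) * (K / d n ^ 3 * E n * exp ((1 + H n) ^ 3 * E n + H n * d n))"
      proof -
        have "(1 + h) ^ 3 * B \<le> (1 + h) ^ 3 * E n" using B h0 by (intro mult_left_mono) auto
        also have "\<dots> \<le> (1 + H n) ^ 3 * E n" using hH h0 E0 by (intro mult_right_mono power_mono) auto
        finally have ex: "exp ((1 + h) ^ 3 * B + h * d n) \<le> exp ((1 + H n) ^ 3 * E n + H n * d n)"
          using hd by simp
        have "K / d n ^ 3 * B \<le> K / d n ^ 3 * E n" using B K d by (intro mult_left_mono) auto
        then have "K / d n ^ 3 * B * exp ((1 + h) ^ 3 * B + h * d n)
            \<le> K / d n ^ 3 * E n * exp ((1 + h) ^ 3 * B + h * d n)" by (rule mult_right_mono) simp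
        also have "\<dots> \<le> K / d n ^ 3 * E n * exp ((1 + H n) ^ 3 * E n + H n * d n)"
          using ex K d E0 by (intro mult_left_mono) auto
        finally have "(1 + h) * (K / d n ^ 3 * B * exp ((1 + h) ^ 3 * B + h * d n))
            \<le> (1 + h) * (K / d n ^ 3 * E n * exp ((1 + H n) ^ 3 * E n + H n * d n))"
          using h0 by (intro mult_left_mono) auto
        also have "\<dots> \<le> (1 + H n) * (K / d n ^ 3 * E n * exp ((1 + H n) ^ 3 * E n + H n * d n))"
          using hH K d E0 by (intro mult_right_mono) auto
        finally show ?thesis .
      qed
      ultimately show ?thesis unfolding rate_def by (intro mult_left_mono) auto
    qed
    finally show ?case by (simp add: Q_def)
  qed
  have rate: "rate \<longlonglongrightarrow> 0"
  proof -
    have q8: "(q - 2) / 8 > 0" using q by simp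
    have "(\<lambda>n. (1 + H n) * (W * real n powr (- r))) \<longlonglongrightarrow> 0" if "r > 0" for r
      unfolding H_def using \<kappa> that by real_asymp
    note 1 = this[OF q8]
    have 2: "(\<lambda>n. (1 + H n) * d n * exp (H n * d n)) \<longlonglongrightarrow> 0"
      unfolding H_def d_def using \<kappa> by real_asymp
    \<comment> \<open>All factors but \<open>E n\<close> grow at most like powers of log n, and the
      exponent itself tends to 0.\<close>
    have 3: "(\<lambda>n. (1 + H n) * (K / d n ^ 3 * E n * exp ((1 + H n) ^ 3 * E n + H n * d n))) \<longlonglongrightarrow> 0"
      unfolding H_def d_def E_def using \<kappa> \<epsilon>(1) C K by real_asymp
    show ?thesis unfolding rate_def
      using tendsto_mult_right_zero[OF tendsto_add_zero[OF tendsto_add_zero[OF 1 2] 3], of "10 * exp 2"] .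
  qed
  have "(\<lambda>n. P n / (1 - Phi (x n)) - 1) \<longlonglongrightarrow> 0"
    by (rule Lim_null_comparison[OF _ rate]) (use le_rate in simp)
  then show ?thesis unfolding P_def by (rule LIM_zero_cancel)
qed

subsection \<open>Association without correlation\<close>

lemma associatedD:
  assumes "associated M X" "coordwise_mono k f" "coordwise_mono k g"
    and "\<And>\<omega>. f (initvec X k \<omega>) = F \<omega>" "\<And>\<omega>. g (initvec X k \<omega>) = G \<omega>"
    and "integrable M F" "integrable M G" "integrable M (\<lambda>\<omega>. F \<omega> * G \<omega>)"
  shows "(\<integral>\<omega>. F \<omega> \<partial>M) * (\<integral>\<omega>. G \<omega> \<partial>M) \<le> (\<integral>\<omega>. F \<omega> * G \<omega> \<partial>M)"
proof -
  have "0 \<le> (\<integral>\<omega>. f (initvec X k \<omega>) * g (initvec X k \<omega>) \<partial>M)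
             - (\<integral>\<omega>. f (initvec X k \<omega>) \<partial>M) * (\<integral>\<omega>. g (initvec X k \<omega>) \<partial>M)"
    using assms(1)[unfolded associated_def, rule_format, of k f g] assms(2-) by simp
  then show ?thesis using assms(4,5) by simp
qed

lemma (in prob_space) integrable_mult_square_integrable:
  fixes U V :: "'a \<Rightarrow> real"
  assumes "U \<in> borel_measurable M" "V \<in> borel_measurable M"
    and "integrable M (\<lambda>\<omega>. (U \<omega>)\<^sup>2)" "integrable M (\<lambda>\<omega>. (V \<omega>)\<^sup>2)"
  shows "integrable M (\<lambda>\<omega>. U \<omega> * V \<omega>)"
proof (rule Bochner_Integration.integrable_bound)
  show "integrable M (\<lambda>\<omega>. (U \<omega>)\<^sup>2 + (V \<omega>)\<^sup>2)" using assms by simp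
  have "\<bar>a * b\<bar> \<le> a\<^sup>2 + b\<^sup>2" for a b :: real
  proof -
    have "0 \<le> (\<bar>a\<bar> - \<bar>b\<bar>)\<^sup>2" by simp
    also have "\<dots> = a\<^sup>2 + b\<^sup>2 - 2 * \<bar>a * b\<bar>" by (simp add: power2_diff abs_mult)
    finally show ?thesis using abs_ge_zero[of "a * b"] by linarith
  qed
  then show "AE \<omega> in M. norm (U \<omega> * V \<omega>) \<le> norm ((U \<omega>)\<^sup>2 + (V \<omega>)\<^sup>2)" by auto
qed (use assms in measurable)

text \<open>Continuous substitutes for indicators of half-lines. Given monotonicity, the one-sided
  increment bound is the Lipschitz condition, in the form in which L t - \<phi> t is seen to be
  nondecreasing.\<close>

definition unit_ramp :: "real \<Rightarrow> (real \<Rightarrow> real) \<Rightarrow> bool" where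
  "unit_ramp L \<phi> \<longleftrightarrow> mono \<phi> \<and> (\<forall>t. 0 \<le> \<phi> t \<and> \<phi> t \<le> 1) \<and> (\<forall>s t. s \<le> t \<longrightarrow> \<phi> t - \<phi> s \<le> L * (t - s))"

text \<open>Newman's argument: if f is coordinatewise L-Lipschitz and nondecreasing, then both f and
  L (x_1 + ... + x_k) - f are nondecreasing, so association squeezes Cov(f, g) between 0 and a sum of
  covariances of the variables themselves.\<close>
lemma (in prob_space) associated_uncorrelated_prod:
  fixes X :: "nat \<Rightarrow> 'a \<Rightarrow> real"
  assumes meas: "\<And>n. n \<ge> 1 \<Longrightarrow> X n \<in> borel_measurable M"
    and sq: "\<And>n. n \<ge> 1 \<Longrightarrow> integrable M (\<lambda>\<omega>. (X n \<omega>)\<^sup>2)"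
    and assoc: "associated M X"
    and uncorr: "\<And>i j. 1 \<le> i \<Longrightarrow> i < j \<Longrightarrow> expectation (\<lambda>\<omega>. X i \<omega> * X j \<omega>) = expectation (X i) * expectation (X j)"
    and ramp: "\<And>i. unit_ramp L (\<phi> i)"
  shows "expectation (\<lambda>\<omega>. \<Prod>i=1..k. \<phi> i (X i \<omega>)) = (\<Prod>i=1..k. expectation (\<lambda>\<omega>. \<phi> i (X i \<omega>)))"
proof (induction k)
  case 0
  show ?case using prob_space by simp
next
  case (Suc k)
  have mono: "\<phi> i s \<le> \<phi> i t" if "s \<le> t" for i s t using ramp[of i] that by (auto simp: unit_ramp_def mono_def)
  have b0: "0 \<le> \<phi> i t" and b1: "\<phi> i t \<le> 1" for i t using ramp[of i] by (auto simp: unit_ramp_def)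
  have lip: "\<phi> i t - \<phi> i s \<le> L * (t - s)" if "s \<le> t" for i s t using ramp[of i] that by (auto simp: unit_ramp_def)
  have L: "0 \<le> L" using lip[of 0 1 0] mono[of 0 1 0] by simp
  have [measurable]: "\<phi> i \<in> borel_measurable borel" for i
    using ramp[of i] by (auto simp: unit_ramp_def intro: borel_measurable_mono)
  note [measurable] = meas
  have X1: "integrable M (X i)" if "i \<ge> 1" for i
    using square_integrable_imp_integrable[OF meas sq] that by simp
  have XX: "integrable M (\<lambda>\<omega>. X i \<omega> * X j \<omega>)" if "i \<ge> 1" "j \<ge> 1" for i j
    by (rule integrable_mult_square_integrable[OF meas meas sq sq]) (rule that)+
  let ?j = "Suc k"
  define f where "f y = (\<Prod>i=1..k. \<phi> i (y i))" for y :: "nat \<Rightarrow> real"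
  define f' where "f' y = L * (\<Sum>i=1..k. y i)" for y :: "nat \<Rightarrow> real"
  define F where "F \<omega> = (\<Prod>i=1..k. \<phi> i (X i \<omega>))" for \<omega>
  define F' where "F' \<omega> = L * (\<Sum>i=1..k. X i \<omega>)" for \<omega>
  define G where "G \<omega> = \<phi> ?j (X ?j \<omega>)" for \<omega>
  define G' where "G' \<omega> = L * X ?j \<omega>" for \<omega>
  have f01: "0 \<le> f y" "f y \<le> 1" for y unfolding f_def using b0 b1 by (auto intro!: prod_nonneg prod_le_1)
  have iv: "f (initvec X ?j \<omega>) = F \<omega>" "f' (initvec X ?j \<omega>) = F' \<omega>"
    "\<phi> ?j (initvec X ?j \<omega> ?j) = G \<omega>" "L * initvec X ?j \<omega> ?j = G' \<omega>" for \<omega>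
    by (auto simp: f_def f'_def F_def F'_def G_def G'_def initvec_def intro!: prod.cong sum.cong)
  have fmono: "coordwise_mono ?j f"
    unfolding coordwise_mono_def f_def by (auto intro!: prod_mono b0 mono)
  have f'mono: "coordwise_mono ?j f'"
    unfolding coordwise_mono_def f'_def using L by (auto intro!: mult_left_mono sum_mono)
  have dmono: "coordwise_mono ?j (\<lambda>y. f' y - f y)"
    unfolding coordwise_mono_def
  proof (intro ballI impI)
    fix y z :: "nat \<Rightarrow> real" assume yz: "\<forall>i\<in>{1..?j}. y i \<le> z i"
    \<comment> \<open>A product of factors in [0,1] changes by at most the sum of the changes of its
      factors.\<close>
    have "norm (f z - f y) \<le> (\<Sum>i=1..k. norm (\<phi> i (z i) - \<phi> i (y i)))"
      unfolding f_def by (rule norm_prod_diff) (auto simp: b0 b1)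
    also have "\<dots> \<le> (\<Sum>i=1..k. L * (z i - y i))"
      using yz mono lip by (intro sum_mono) (auto simp: abs_of_nonneg)
    also have "\<dots> = f' z - f' y" by (simp add: f'_def sum_subtractf sum_distrib_left[symmetric] right_diff_distrib)
    finally show "f' y - f y \<le> f' z - f z" by simp
  qed
  have gmono: "coordwise_mono ?j (\<lambda>y. \<phi> ?j (y ?j))"
    unfolding coordwise_mono_def by (auto intro!: mono)
  have hmono: "coordwise_mono ?j (\<lambda>y. L * y ?j - \<phi> ?j (y ?j))"
    unfolding coordwise_mono_def
  proof (intro ballI impI)
    fix y z :: "nat \<Rightarrow> real" assume "\<forall>i\<in>{1..?j}. y i \<le> z i"
    then have "y ?j \<le> z ?j" by simp
    from lip[OF this, of ?j] show "L * y ?j - \<phi> ?j (y ?j) \<le> L * z ?j - \<phi> ?j (z ?j)"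
      by (simp add: right_diff_distrib)
  qed
  have [measurable]: "X i \<in> borel_measurable M" if "i \<in> {1..k}" for i using that meas by simp
  have [measurable]: "X ?j \<in> borel_measurable M" using meas by simp
  have Fm[measurable]: "F \<in> borel_measurable M"
    unfolding F_def[abs_def] by (rule borel_measurable_prod) simp
  have Gm[measurable]: "G \<in> borel_measurable M" unfolding G_def[abs_def] by measurable
  have Fb: "\<bar>F \<omega>\<bar> \<le> 1" and Gb: "\<bar>G \<omega>\<bar> \<le> 1" for \<omega>
    using f01[of "initvec X ?j \<omega>"] b0 b1 by (auto simp: iv G_def)
  have iF: "integrable M F" and iG: "integrable M G"
    using Fb Gb by (auto intro!: integrable_const_bound[where B = 1])
  have iF': "integrable M F'" and iG': "integrable M G'"
    using X1 by (auto simp: F'_def[abs_def] G'_def[abs_def])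
  have bdd: "integrable M (\<lambda>\<omega>. U \<omega> * V \<omega>)"
    if "integrable M U" "V \<in> borel_measurable M" "\<And>\<omega>. \<bar>V \<omega>\<bar> \<le> 1" for U V :: "'a \<Rightarrow> real"
    by (rule Bochner_Integration.integrable_bound[OF that(1)])
       (use that in \<open>auto simp: abs_mult intro!: mult_left_le\<close>)
  have iFG: "integrable M (\<lambda>\<omega>. F \<omega> * G \<omega>)" by (rule bdd[OF iF Gm Gb])
  have iF'G: "integrable M (\<lambda>\<omega>. F' \<omega> * G \<omega>)" by (rule bdd[OF iF' Gm Gb])
  have F'G'eq: "F' \<omega> * G' \<omega> = L * L * (\<Sum>i=1..k. X i \<omega> * X ?j \<omega>)" for \<omega>
    by (simp add: F'_def G'_def sum_distrib_right[symmetric] mult_ac)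
  have iF'G': "integrable M (\<lambda>\<omega>. F' \<omega> * G' \<omega>)"
    unfolding F'G'eq by (intro integrable_mult_right Bochner_Integration.integrable_sum XX) auto
  have "expectation (\<lambda>\<omega>. F' \<omega> * G' \<omega>) = L * L * (\<Sum>i=1..k. expectation (\<lambda>\<omega>. X i \<omega> * X ?j \<omega>))"
    unfolding F'G'eq using XX by simp
  also have "\<dots> = L * L * (\<Sum>i=1..k. expectation (X i) * expectation (X ?j))"
    using uncorr by (intro arg_cong[where f = "\<lambda>t. L * L * t"] sum.cong) auto
  also have "\<dots> = expectation F' * expectation G'"
    using X1 by (simp add: F'_def[abs_def] G'_def[abs_def] sum_distrib_right[symmetric] mult_ac)
  finally have c0: "expectation (\<lambda>\<omega>. F' \<omega> * G' \<omega>) = expectation F' * expectation G'" .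
  \<comment> \<open>As covariances: 0 <= Cov(F, G) <= Cov(F', G) <= Cov(F', G') = 0. The
    inequalities apply association to the pairs (F, G), (F' - F, G) and (F', G' - G).\<close>
  have 1: "expectation F * expectation G \<le> expectation (\<lambda>\<omega>. F \<omega> * G \<omega>)"
    by (rule associatedD[OF assoc fmono gmono iv(1,3) iF iG iFG])
  have "expectation (\<lambda>\<omega>. F' \<omega> - F \<omega>) * expectation G \<le> expectation (\<lambda>\<omega>. (F' \<omega> - F \<omega>) * G \<omega>)"
    by (rule associatedD[OF assoc dmono gmono])
       (use iF' iF iG iF'G iFG in \<open>auto simp: iv left_diff_distrib\<close>)
  then have 2: "expectation F' * expectation G - expectation F * expectation G
      \<le> expectation (\<lambda>\<omega>. F' \<omega> * G \<omega>) - expectation (\<lambda>\<omega>. F \<omega> * G \<omega>)"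
    using iF' iF iF'G iFG by (simp add: left_diff_distrib)
  have "expectation F' * expectation (\<lambda>\<omega>. G' \<omega> - G \<omega>) \<le> expectation (\<lambda>\<omega>. F' \<omega> * (G' \<omega> - G \<omega>))"
    by (rule associatedD[OF assoc f'mono hmono])
       (use iF' iG iG' iF'G iF'G' in \<open>auto simp: iv right_diff_distrib\<close>)
  then have 3: "expectation F' * expectation G' - expectation F' * expectation G
      \<le> expectation (\<lambda>\<omega>. F' \<omega> * G' \<omega>) - expectation (\<lambda>\<omega>. F' \<omega> * G \<omega>)"
    using iG iG' iF'G iF'G' by (simp add: right_diff_distrib)
  have "expectation (\<lambda>\<omega>. F \<omega> * G \<omega>) = expectation F * expectation G" using 1 2 3 c0 by linarith
  then show ?case using Suc.IH by (simp add: F_def[abs_def] G_def[abs_def])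
qed

text \<open>The Lipschitz constant m may grow without bound because the product formula is exact for
  each m. The ramps vanish at a, so the limits are indicators of open half-lines.\<close>

lemma unit_ramp_approx:
  "unit_ramp (real m) (\<lambda>t. min 1 (max 0 (real m * (t - a))))"
  "(\<lambda>m. min 1 (max 0 (real m * (t - a)))) \<longlonglongrightarrow> indicator {a<..} t"
proof -
  have "min 1 (max 0 (real m * (t - a))) - min 1 (max 0 (real m * (s - a))) \<le> real m * (t - s)"
    if "s \<le> t" for s t
  proof -
    have "0 \<le> real m * (t - s)" using that by simp
    moreover have "real m * (t - a) = real m * (s - a) + real m * (t - s)" by (simp add: algebra_simps)
    ultimately show ?thesis by linarith
  qed
  then show "unit_ramp (real m) (\<lambda>t. min 1 (max 0 (real m * (t - a))))"
    unfolding unit_ramp_def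
    by (auto intro!: monoI min.mono max.mono mult_left_mono)
  show "(\<lambda>m. min 1 (max 0 (real m * (t - a)))) \<longlonglongrightarrow> indicator {a<..} t"
  proof (cases "t > a")
    case True
    obtain N :: nat where N: "1 / (t - a) < real N" using reals_Archimedean2 by blast
    have "min 1 (max 0 (real m * (t - a))) = 1" if "m \<ge> N" for m
    proof -
      have "1 < real N * (t - a)" using N True by (simp add: divide_less_eq)
      also have "\<dots> \<le> real m * (t - a)" using that True by (intro mult_right_mono) auto
      finally show ?thesis by simp
    qed
    then show ?thesis using True by (intro tendsto_eventually) (auto simp: eventually_sequentially)
  next
    case False
    then have "min 1 (max 0 (real m * (t - a))) = 0" for m by (simp add: mult_le_0_iff)
    then show ?thesis using False by simp
  qed
qed

text \<open>Dominated convergence carries the product formula from ramps to half-lines, which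
  together with the whole line form an intersection-stable generator of the Borel sets.\<close>

lemma (in prob_space) associated_uncorrelated_indep:
  fixes X :: "nat \<Rightarrow> 'a \<Rightarrow> real"
  assumes meas: "\<And>n. n \<ge> 1 \<Longrightarrow> X n \<in> borel_measurable M"
    and sq: "\<And>n. n \<ge> 1 \<Longrightarrow> integrable M (\<lambda>\<omega>. (X n \<omega>)\<^sup>2)"
    and assoc: "associated M X"
    and uncorr: "\<And>i j. 1 \<le> i \<Longrightarrow> i < j \<Longrightarrow> expectation (\<lambda>\<omega>. X i \<omega> * X j \<omega>) = expectation (X i) * expectation (X j)"
    and n: "n \<ge> 1"
  shows "indep_vars (\<lambda>_. borel) X {1..n}"
proof -
  let ?E = "insert UNIV (range (\<lambda>a::real. {a<..}))"
  have "(\<forall>A\<in>{1..n} \<rightarrow> ?E. prob (\<Inter>j\<in>{1..n}. X j -` A j \<inter> space M) = (\<Prod>j\<in>{1..n}. prob (X j -` A j \<inter> space M)))"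
  proof
    fix A assume A: "A \<in> {1..n} \<rightarrow> ?E"
    have [measurable]: "X j \<in> borel_measurable M" if "j \<in> {1..n}" for j using that meas by simp
    have "\<exists>\<phi>. (\<forall>m. unit_ramp (real m) (\<phi> m)) \<and> (j \<in> {1..n} \<longrightarrow> (\<forall>t. (\<lambda>m. \<phi> m t) \<longlonglongrightarrow> indicator (A j) t))" for j
    proof (cases "j \<in> {1..n}")
      case True
      then have "A j \<in> ?E" using A by blast
      then consider "A j = UNIV" | a where "A j = {a<..}" by blast
      then show ?thesis
      proof cases
        case 1
        then show ?thesis by (intro exI[of _ "\<lambda>m t. 1"]) (auto simp: unit_ramp_def mono_def)
      next
        case (2 a)
        then show ?thesis
          using unit_ramp_approx by (intro exI[of _ "\<lambda>m t. min 1 (max 0 (real m * (t - a)))"]) auto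
      qed
    qed (auto intro!: exI[of _ "\<lambda>m t. 1"] simp: unit_ramp_def mono_def)
    then obtain \<phi> where ramp: "\<And>j m. unit_ramp (real m) (\<phi> j m)"
      and lim: "\<And>j t. j \<in> {1..n} \<Longrightarrow> (\<lambda>m. \<phi> j m t) \<longlonglongrightarrow> indicator (A j) t"
      by metis
    have b: "0 \<le> \<phi> j m t" "\<phi> j m t \<le> 1" for j m t using ramp[of m j] by (auto simp: unit_ramp_def)
    have [measurable]: "\<phi> j m \<in> borel_measurable borel" for j m
      using ramp[of m j] by (auto simp: unit_ramp_def intro: borel_measurable_mono)
    have Am: "A j \<in> sets borel" if "j \<in> {1..n}" for j
    proof -
      have "A j \<in> ?E" using A that by blast
      then consider "A j = UNIV" | a where "A j = {a<..}" by blast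
      then show ?thesis by cases simp_all
    qed
    have ev: "X j -` A j \<inter> space M \<in> events" if "j \<in> {1..n}" for j
      using Am[OF that] that by (intro measurable_sets[of _ _ borel]) auto
    have 1: "(\<lambda>m. expectation (\<lambda>\<omega>. \<Prod>j=1..n. \<phi> j m (X j \<omega>))) \<longlonglongrightarrow>
        expectation (\<lambda>\<omega>. indicator (\<Inter>j\<in>{1..n}. X j -` A j \<inter> space M) \<omega>)"
    proof (rule integral_dominated_convergence[where w = "\<lambda>_. 1"])
      show "(indicat_real (\<Inter>j\<in>{1..n}. X j -` A j \<inter> space M)) \<in> borel_measurable M"
        using ev n by (intro borel_measurable_indicator sets.finite_INT) auto
      show "AE \<omega> in M. (\<lambda>m. \<Prod>j=1..n. \<phi> j m (X j \<omega>)) \<longlonglongrightarrow> indicator (\<Inter>j\<in>{1..n}. X j -` A j \<inter> space M) \<omega>"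
      proof (rule AE_I2)
        fix \<omega> assume w: "\<omega> \<in> space M"
        have "(\<lambda>m. \<Prod>j=1..n. \<phi> j m (X j \<omega>)) \<longlonglongrightarrow> (\<Prod>j=1..n. indicator (A j) (X j \<omega>))"
          by (intro tendsto_prod lim)
        also have "(\<Prod>j=1..n. indicator (A j) (X j \<omega>)) = indicat_real (\<Inter>j\<in>{1..n}. X j -` A j \<inter> space M) \<omega>"
        proof (cases "\<forall>j\<in>{1..n}. X j \<omega> \<in> A j")
          case True
          then show ?thesis using w n by (auto simp: indicator_def)
        next
          case False
          then obtain j where "j \<in> {1..n}" "X j \<omega> \<notin> A j" by auto
          then show ?thesis by (auto simp: indicator_def intro!: prod_zero)
        qed
        finally show "(\<lambda>m. \<Prod>j=1..n. \<phi> j m (X j \<omega>)) \<longlonglongrightarrow> indicator (\<Inter>j\<in>{1..n}. X j -` A j \<inter> space M) \<omega>" .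
      qed
      show "AE \<omega> in M. norm (\<Prod>j=1..n. \<phi> j m (X j \<omega>)) \<le> 1" for m
        by (auto simp: abs_prod b intro!: prod_le_1)
      show "(\<lambda>\<omega>. \<Prod>j=1..n. \<phi> j m (X j \<omega>)) \<in> borel_measurable M" for m
        by (rule borel_measurable_prod) simp
    qed simp
    have 2: "(\<lambda>m. expectation (\<lambda>\<omega>. \<phi> j m (X j \<omega>))) \<longlonglongrightarrow> prob (X j -` A j \<inter> space M)"
      if j: "j \<in> {1..n}" for j
    proof -
      have "(\<lambda>m. expectation (\<lambda>\<omega>. \<phi> j m (X j \<omega>))) \<longlonglongrightarrow> expectation (indicator (X j -` A j \<inter> space M))"
      proof (rule integral_dominated_convergence[where w = "\<lambda>_. 1"])
        show "indicat_real (X j -` A j \<inter> space M) \<in> borel_measurable M" using ev[OF j] by simp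
        show "AE \<omega> in M. (\<lambda>m. \<phi> j m (X j \<omega>)) \<longlonglongrightarrow> indicator (X j -` A j \<inter> space M) \<omega>"
        proof (rule AE_I2)
          fix \<omega> assume "\<omega> \<in> space M"
          then show "(\<lambda>m. \<phi> j m (X j \<omega>)) \<longlonglongrightarrow> indicator (X j -` A j \<inter> space M) \<omega>"
            using lim[OF j, of "X j \<omega>"] by (simp add: indicator_def)
        qed
      qed (use j b in auto)
      then show ?thesis using ev[OF j] by simp
    qed
    have eq: "expectation (\<lambda>\<omega>. \<Prod>j=1..n. \<phi> j m (X j \<omega>)) = (\<Prod>j=1..n. expectation (\<lambda>\<omega>. \<phi> j m (X j \<omega>)))" for m
      by (rule associated_uncorrelated_prod[OF meas sq assoc uncorr ramp])
    have "(\<lambda>m. expectation (\<lambda>\<omega>. \<Prod>j=1..n. \<phi> j m (X j \<omega>))) \<longlonglongrightarrow> (\<Prod>j=1..n. prob (X j -` A j \<inter> space M))"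
      unfolding eq
      by (intro tendsto_prod 2)
    from LIMSEQ_unique[OF 1 this]
    show "prob (\<Inter>j\<in>{1..n}. X j -` A j \<inter> space M) = (\<Prod>j\<in>{1..n}. prob (X j -` A j \<inter> space M))"
      using ev n by (simp add: sets.finite_INT)
  qed
  moreover have "sets borel = sigma_sets UNIV ?E"
  proof
    have "sets borel = sigma_sets UNIV (range (\<lambda>a::real. {a<..}))"
      unfolding borel_Ioi by (rule sets_measure_of) simp
    also have "\<dots> \<subseteq> sigma_sets UNIV ?E" by (rule sigma_sets_mono') auto
    finally show "sets borel \<subseteq> sigma_sets UNIV ?E" .
    have "?E \<subseteq> sets (borel :: real measure)" by (intro insert_subsetI image_subsetI) simp_all
    from sets.sigma_sets_subset[OF this] show "sigma_sets UNIV ?E \<subseteq> sets (borel :: real measure)" by simp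
  qed
  moreover have "Int_stable ?E"
  proof (rule Int_stableI)
    fix a b assume "a \<in> ?E" "b \<in> ?E"
    then consider "a = UNIV" | "b = UNIV" | u w where "a = {u<..}" "b = {w<..}" by blast
    then show "a \<inter> b \<in> ?E"
    proof cases
      case (3 u w)
      then have "a \<inter> b = {max u w<..}" by auto
      then show ?thesis by blast
    qed (use \<open>a \<in> ?E\<close> \<open>b \<in> ?E\<close> in simp_all)
  qed
  ultimately show ?thesis
    using n meas by (subst indep_vars_finite[where E = "\<lambda>_. ?E"]) simp_all
qed



section \<open>Stationarity and the vanishing of the covariances\<close>

lemma stationary_distr:
  assumes stat: "strictly_stationary M X" and meas: "\<And>n. n \<ge> 1 \<Longrightarrow> X n \<in> borel_measurable M" and i: "i \<ge> 1"
  shows "distr M borel (X i) = distr M borel (X 1)"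
proof -
  let ?P = "PiM {1..1} (\<lambda>_. borel) :: (nat \<Rightarrow> real) measure"
  have m[measurable]: "X (j + h) \<in> borel_measurable M" if "j \<in> {1..1}" for j h using that meas by simp
  have eq: "distr (distr M ?P (\<lambda>\<omega>. \<lambda>j\<in>{1..1}. X (j + h) \<omega>)) borel (\<lambda>y. y 1) = distr M borel (X (1 + h))" for h
    by (subst distr_distr) (auto simp: comp_def intro!: measurable_restrict m)
  have "distr M ?P (\<lambda>\<omega>. \<lambda>j\<in>{1..1}. X (j + (i - 1)) \<omega>) = distr M ?P (\<lambda>\<omega>. \<lambda>j\<in>{1..1}. X (j + 0) \<omega>)"
    using stat[unfolded strictly_stationary_def, rule_format, of 1 "i - 1"] by simp
  then show ?thesis using eq[of "i - 1"] eq[of 0] i by simp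
qed

lemma stationary_product_moment:
  assumes stat: "strictly_stationary M X" and meas: "\<And>n. n \<ge> 1 \<Longrightarrow> X n \<in> borel_measurable M" and i: "i \<ge> 1"
  shows "(\<integral>\<omega>. X i \<omega> * X (i + j) \<omega> \<partial>M) = (\<integral>\<omega>. X 1 \<omega> * X (1 + j) \<omega> \<partial>M)"
proof -
  let ?P = "PiM {1..1+j} (\<lambda>_. borel) :: (nat \<Rightarrow> real) measure"
  have m[measurable]: "X (l + h) \<in> borel_measurable M" if "l \<in> {1..1+j}" for l h using that meas by simp
  have g[measurable]: "(\<lambda>y. y 1 * y (1 + j)) \<in> borel_measurable ?P"
    by (intro borel_measurable_times measurable_component_singleton) auto
  have eq: "(\<integral>y. y 1 * y (1 + j) \<partial>distr M ?P (\<lambda>\<omega>. \<lambda>l\<in>{1..1+j}. X (l + h) \<omega>))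
      = (\<integral>\<omega>. X (1 + h) \<omega> * X (1 + j + h) \<omega> \<partial>M)" for h
    by (subst integral_distr) (auto intro!: measurable_restrict m g)
  have "distr M ?P (\<lambda>\<omega>. \<lambda>l\<in>{1..1+j}. X (l + (i - 1)) \<omega>) = distr M ?P (\<lambda>\<omega>. \<lambda>l\<in>{1..1+j}. X (l + 0) \<omega>)"
    using stat[unfolded strictly_stationary_def, rule_format, of "1 + j" "i - 1"] by simp
  then show ?thesis using eq[of "i - 1"] eq[of 0] i by (simp add: add.commute)
qed

lemma (in prob_space) associated_product_moment_nonneg:
  fixes X :: "nat \<Rightarrow> 'a \<Rightarrow> real"
  assumes meas: "\<And>n. n \<ge> 1 \<Longrightarrow> X n \<in> borel_measurable M"
    and sq: "\<And>n. n \<ge> 1 \<Longrightarrow> integrable M (\<lambda>\<omega>. (X n \<omega>)\<^sup>2)"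
    and centered: "\<And>n. n \<ge> 1 \<Longrightarrow> expectation (X n) = 0"
    and assoc: "associated M X" and ij: "1 \<le> i" "i \<le> j"
  shows "0 \<le> expectation (\<lambda>\<omega>. X i \<omega> * X j \<omega>)"
proof -
  have X1: "integrable M (X i)" if "i \<ge> 1" for i
    using square_integrable_imp_integrable[OF meas sq] that by simp
  have "expectation (X i) * expectation (X j) \<le> expectation (\<lambda>\<omega>. X i \<omega> * X j \<omega>)"
    by (rule associatedD[OF assoc, of j "\<lambda>y. y i" "\<lambda>y. y j"])
       (use ij X1 integrable_mult_square_integrable[OF meas meas sq sq] in
         \<open>auto simp: coordwise_mono_def initvec_def\<close>)
  then show ?thesis using centered ij by simp
qed

text \<open>Each of the first n increments of the variance falls short of the limit rate, the first one by
  twice the total covariance; hence a rate faster than 1/n in (A2) forces all covariances to vanish.\<close>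
lemma (in prob_space) stationary_associated_variance_le:
  fixes X :: "nat \<Rightarrow> 'a \<Rightarrow> real"
  assumes meas: "\<And>n. n \<ge> 1 \<Longrightarrow> X n \<in> borel_measurable M"
    and sq: "\<And>n. n \<ge> 1 \<Longrightarrow> integrable M (\<lambda>\<omega>. (X n \<omega>)\<^sup>2)"
    and stat: "strictly_stationary M X"
    and c: "\<And>j. c j = expectation (\<lambda>\<omega>. X 1 \<omega> * X (1 + j) \<omega>)" and c0: "\<And>j. 0 \<le> c j"
    and summ: "summable (\<lambda>j. c (Suc j))" and C: "C = (\<Sum>j. c (Suc j))" and n: "n \<ge> 1"
  shows "expectation (\<lambda>\<omega>. (\<Sum>j=1..n. X j \<omega>)\<^sup>2) \<le> real n * (c 0 + 2 * C) - 2 * C"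
  using n
proof (induction n rule: dec_induct)
  case base
  show ?case using c[of 0] by (simp add: power2_eq_square)
next
  case (step n)
  let ?S = "\<lambda>\<omega>. \<Sum>j=1..n. X j \<omega>" and ?X = "X (Suc n)"
  note XX = integrable_mult_square_integrable[OF meas meas sq sq]
  have iSS: "integrable M (\<lambda>\<omega>. ?S \<omega> * ?S \<omega>)"
    unfolding sum_product by (intro Bochner_Integration.integrable_sum XX) auto
  have iSX: "integrable M (\<lambda>\<omega>. ?S \<omega> * ?X \<omega>)"
    unfolding sum_distrib_right by (intro Bochner_Integration.integrable_sum XX) auto
  have "expectation (\<lambda>\<omega>. (\<Sum>j=1..Suc n. X j \<omega>)\<^sup>2)
      = expectation (\<lambda>\<omega>. ?S \<omega> * ?S \<omega> + 2 * (?S \<omega> * ?X \<omega>) + ?X \<omega> * ?X \<omega>)"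
    by (intro Bochner_Integration.integral_cong) (auto simp: power2_eq_square algebra_simps)
  also have "\<dots> = expectation (\<lambda>\<omega>. (?S \<omega>)\<^sup>2) + 2 * expectation (\<lambda>\<omega>. ?S \<omega> * ?X \<omega>) + expectation (\<lambda>\<omega>. ?X \<omega> * ?X \<omega>)"
    using iSS iSX XX[of "Suc n" "Suc n"] by (simp add: power2_eq_square)
  also have "expectation (\<lambda>\<omega>. ?X \<omega> * ?X \<omega>) = c 0"
    using stationary_product_moment[OF stat meas, of "Suc n" 0] c[of 0] by simp
  also have "expectation (\<lambda>\<omega>. ?S \<omega> * ?X \<omega>) = (\<Sum>j=1..n. expectation (\<lambda>\<omega>. X j \<omega> * ?X \<omega>))"
    using XX by (simp add: sum_distrib_right)
  also have "\<dots> = (\<Sum>j=1..n. c (Suc n - j))"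
  proof (rule sum.cong)
    fix j assume "j \<in> {1..n}"
    then show "expectation (\<lambda>\<omega>. X j \<omega> * ?X \<omega>) = c (Suc n - j)"
      using stationary_product_moment[OF stat meas, of j "Suc n - j"] c by simp
  qed simp
  \<comment> \<open>The lags of the new variable against the earlier ones run through 1, ..., n, so
    this is a partial sum of the nonnegative series with total \<open>C\<close>.\<close>
  also have "\<dots> = (\<Sum>j<n. c (Suc j))"
    by (rule sum.reindex_bij_witness[of _ "\<lambda>j. n - j" "\<lambda>j. n - j"]) (auto simp: Suc_diff_le)
  also have "\<dots> \<le> C" unfolding C using summ c0 by (intro sum_le_suminf) auto
  finally show ?case using step by (simp add: algebra_simps)
qed

lemma nonpos_if_le_negative_power:
  fixes C :: real
  assumes "\<And>n::nat. n \<ge> N \<Longrightarrow> C \<le> K * real n powr (- e)" "e > 0"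
  shows "C \<le> 0"
proof (rule LIMSEQ_le_const)
  show "(\<lambda>n. K * real n powr (- e)) \<longlonglongrightarrow> 0"
    using assms(2) by (intro tendsto_mult_right_zero tendsto_neg_powr filterlim_real_sequentially) auto
qed (use assms(1) in auto)

theorem theorem5p5:
  fixes M :: "'a measure" and X :: "nat \<Rightarrow> 'a \<Rightarrow> real"
    and c :: "nat \<Rightarrow> real" and sigma2 :: real
    and S :: "nat \<Rightarrow> 'a \<Rightarrow> real" and s2 :: "nat \<Rightarrow> real"
    and q \<theta> lam :: real and x :: "nat \<Rightarrow> real"
  assumes "prob_space M"
    and meas: "\<And>n. n \<ge> 1 \<Longrightarrow> X n \<in> borel_measurable M"
    and stat: "strictly_stationary M X"
    and centered: "\<And>n. n \<ge> 1 \<Longrightarrow> (\<integral>\<omega>. X n \<omega> \<partial>M) = 0"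
    and sqint: "\<And>n. n \<ge> 1 \<Longrightarrow> integrable M (\<lambda>\<omega>. (X n \<omega>)\<^sup>2)"
    and assoc: "associated M X"
    and c_def: "\<And>j. c j = covar M (X 1) (X (1 + j))"
    and c_summ: "summable (\<lambda>j. c (Suc j))"
    and sigma2_def: "sigma2 = (\<integral>\<omega>. (X 1 \<omega>)\<^sup>2 \<partial>M) + 2 * (\<Sum>j. c (Suc j))"
    and sigma2_pos: "sigma2 > 0"
    and S_def: "\<And>n \<omega>. S n \<omega> = (\<Sum>j=1..n. X j \<omega>)"
    and s2_def: "\<And>n. s2 n = (\<integral>\<omega>. (S n \<omega>)\<^sup>2 \<partial>M)"
    and A1: "q > 2" "integrable M (\<lambda>\<omega>. \<bar>X 1 \<omega>\<bar> powr q)"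
    and A2: "\<theta> > 0"
       "(\<lambda>n. \<bar>s2 n / (real n * sigma2) - 1\<bar>) \<in> O(\<lambda>n. real n powr (- \<theta>))"
    and xi: "limsup (\<lambda>n. ereal ((x n)\<^sup>2 / ln (real n))) = ereal lam"
       "lam < (q - 2) / 2"
    and xii: "\<theta> > 1 + lam"
  shows "(\<lambda>n. measure M {\<omega> \<in> space M. S n \<omega> > x n * sqrt (s2 n)} / (1 - Phi (x n)))
           \<longlonglongrightarrow> 1"
proof -
  interpret prob_space M by fact
  have c: "c j = expectation (\<lambda>\<omega>. X 1 \<omega> * X (1 + j) \<omega>)" for j
    using centered[of 1] centered[of "1 + j"] by (simp add: c_def covar_def)
  have c_nonneg: "0 \<le> c j" for j
    unfolding c by (rule associated_product_moment_nonneg[OF meas sqint centered assoc]) auto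
  define C where "C = (\<Sum>j. c (Suc j))"
  have C0: "0 \<le> C" unfolding C_def by (intro suminf_nonneg c_summ c_nonneg)
  have c0: "c 0 = expectation (\<lambda>\<omega>. (X 1 \<omega>)\<^sup>2)" by (simp add: c power2_eq_square)
  have sig: "sigma2 = c 0 + 2 * C" by (simp add: sigma2_def c0 C_def)
  have var_le: "s2 n \<le> real n * sigma2 - 2 * C" if "n \<ge> 1" for n
    using stationary_associated_variance_le[OF meas sqint stat c c_nonneg c_summ C_def that]
    by (simp add: s2_def S_def sig)
  \<comment> \<open>A limsup of nonnegative terms; with (ii) it yields \<theta> > 1, the form in
    which (ii) is used.\<close>
  have lam0: "0 \<le> lam"
  proof -
    have "0 \<le> limsup (\<lambda>n. ereal ((x n)\<^sup>2 / ln (real n)))"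
    proof (rule le_Limsup)
      show "eventually (\<lambda>n. 0 \<le> ereal ((x n)\<^sup>2 / ln (real n))) sequentially"
        using eventually_ge_at_top[of 1] by eventually_elim auto
    qed simp
    then show ?thesis using xi(1) by simp
  qed
  have "2 * C \<le> 0"
  proof -
    from A2(2) obtain K where K: "K > 0"
      "eventually (\<lambda>n. norm \<bar>s2 n / (real n * sigma2) - 1\<bar> \<le> K * norm (real n powr (- \<theta>))) sequentially"
      by (rule landau_o.bigE) blast
    then obtain N where N: "\<And>n. n \<ge> N \<Longrightarrow> \<bar>s2 n / (real n * sigma2) - 1\<bar> \<le> K * real n powr (- \<theta>)"
      by (auto simp: eventually_sequentially)
    \<comment> \<open>(A2) multiplied by n \<open>sigma2\<close>: the fixed deficit 2 C is compared
      with a power of n whose exponent is negative.\<close>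
    have *: "2 * C \<le> (sigma2 * K) * real n powr (- (\<theta> - 1))" if n: "n \<ge> max N 1" for n
    proof -
      have n0: "real n > 0" using n by simp
      have "2 * C \<le> real n * sigma2 - s2 n" using var_le[of n] n by simp
      also have "\<dots> = (real n * sigma2) * (1 - s2 n / (real n * sigma2))"
        using n0 sigma2_pos by (simp add: field_simps)
      also have "\<dots> \<le> (real n * sigma2) * (K * real n powr (- \<theta>))"
        using N[of n] n n0 sigma2_pos by (intro mult_left_mono) (auto simp: abs_le_iff)
      also have "\<dots> = (sigma2 * K) * (real n powr 1 * real n powr (- \<theta>))" using n0 by simp
      also have "\<dots> = (sigma2 * K) * real n powr (- (\<theta> - 1))"
        using powr_add[of "real n" 1 "- \<theta>"] by simp
      finally show ?thesis .
    qed
    show ?thesis by (rule nonpos_if_le_negative_power[where N = "max N 1", OF *]) (use xii lam0 in auto)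
  qed
  then have C: "C = 0" using C0 by simp
  have cz: "c (Suc j) = 0" for j
    using C c_summ c_nonneg suminf_eq_zero_iff[of "\<lambda>j. c (Suc j)"] by (simp add: C_def)
  have uncorr: "expectation (\<lambda>\<omega>. X i \<omega> * X j \<omega>) = expectation (X i) * expectation (X j)"
    if "1 \<le> i" "i < j" for i j
  proof -
    have "expectation (\<lambda>\<omega>. X i \<omega> * X (i + (j - i)) \<omega>) = c (j - i)"
      unfolding c by (rule stationary_product_moment[OF stat meas that(1)])
    also have "\<dots> = 0" using cz[of "j - i - 1"] that by (simp add: Suc_diff_Suc)
    finally show ?thesis using centered that by simp
  qed
  have ind: "indep_vars (\<lambda>_. borel) X {1..n}" if "n \<ge> 1" for n
    by (rule associated_uncorrelated_indep[OF meas sqint assoc uncorr that])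
  \<comment> \<open>Once the covariances vanish the variance is exactly linear, so the norming by
    \<open>s2\<close> is the exact one for independent summands and no approximation of x is
    needed.\<close>
  have s2: "s2 n = sigma2 * real n" for n
  proof -
    have iXX: "integrable M (\<lambda>\<omega>. X i \<omega> * X j \<omega>)" if "i \<in> {1..n}" "j \<in> {1..n}" for i j
      using that by (intro integrable_mult_square_integrable meas sqint) auto
    have "s2 n = expectation (\<lambda>\<omega>. \<Sum>i=1..n. \<Sum>j=1..n. X i \<omega> * X j \<omega>)"
      by (simp add: s2_def S_def power2_eq_square sum_product)
    also have "\<dots> = (\<Sum>i=1..n. \<Sum>j=1..n. expectation (\<lambda>\<omega>. X i \<omega> * X j \<omega>))"
      using iXX by (subst Bochner_Integration.integral_sum)
        (auto intro!: Bochner_Integration.integrable_sum sum.cong Bochner_Integration.integral_sum)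
    also have "\<dots> = (\<Sum>i=1..n. \<Sum>j=1..n. if j = i then sigma2 else 0)"
    proof (intro sum.cong refl)
      fix i j assume ij: "i \<in> {1..n}" "j \<in> {1..n}"
      have "expectation (\<lambda>\<omega>. X i \<omega> * X i \<omega>) = sigma2"
        using stationary_product_moment[OF stat meas, of i 0] ij c[of 0] by (simp add: sig C)
      moreover have "expectation (\<lambda>\<omega>. X i \<omega> * X j \<omega>) = 0" if "i \<noteq> j"
        using uncorr[of i j] uncorr[of j i] that ij centered by (auto simp: mult.commute neq_iff)
      ultimately show "expectation (\<lambda>\<omega>. X i \<omega> * X j \<omega>) = (if j = i then sigma2 else 0)" by auto
    qed
    also have "\<dots> = sigma2 * real n" by simp
    finally show ?thesis .
  qed
  have "eventually (\<lambda>n. ereal ((x n)\<^sup>2 / ln (real n)) < ereal ((q - 2) / 2)) sequentially"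
    by (rule Limsup_lessD) (use xi in simp)
  \<comment> \<open>The strict inequality for \<open>lam\<close> leaves room to pass from the limsup
    to an eventual bound with the endpoint itself; n > 1 makes the logarithm positive, so that the
    division can be cleared.\<close>
  then have bound: "eventually (\<lambda>n. (x n)\<^sup>2 \<le> (q - 2) / 2 * ln (real n)) sequentially"
    using eventually_gt_at_top[of 1]
  proof eventually_elim
    case (elim n)
    then show ?case by (simp add: divide_less_eq mult.commute)
  qed
  have "(\<lambda>n. prob {\<omega> \<in> space M. (\<Sum>i=1..n. X i \<omega>) > x n * sqrt (sigma2 * real n)} / (1 - Phi (x n))) \<longlonglongrightarrow> 1"
    by (rule iid_moderate_deviation[OF meas ind stationary_distr[OF stat meas] _ _ _ sigma2_pos A1 bound])
       (use centered sqint sig C c0 in auto)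
  then show ?thesis by (simp add: S_def s2)
qed

end
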